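(* Let $d\ge1$ and let $(H_0,H_1,\dots,H_d)\in(0,1)^{d+1}$ satisfy $$2H_0+H_1+\cdots+H_d\le\tfrac34d.$$ Let $\chi:\mathbb R^d\to\mathbb R$ be a non-zero, smooth and compactly supported function. Then, for all $\alpha>0$ and $t>0$, $$\mathbb E\Big[\|\chi\cdot\Psi^{\diamond2}_n(t,\cdot)\|^2_{H^{-2\alpha}(\mathbb R^d)}\Big]\longrightarrow\infty\quad\text{as }n\to\infty.$$
   Context: For $s\in\mathbb R$, $H^s(\mathbb R^d)$ is the Sobolev space with norm $\|f\|_{H^s}=\|\mathcal F^{-1}(\{1+|\cdot|^2\}^{s/2}\mathcal Ff)\|_{L^2(\mathbb R^d)}$. $\{\Psi_n(s,x)\}_{n\ge1,s\ge0,x\in\mathbb R^d}$ is a centered real Gaussian process (with continuous sample paths in $(s,x)$) with covariance $$\mathbb E[\Psi_n(s,x)\Psi_m(t,y)]=c_H^2\int_{D_n\cap D_m}\frac{1}{|\xi|^{2H_0-1}}\prod_{i=1}^d\frac1{|\eta_i|^{2H_i-1}}\gamma_s(\xi,|\eta|)\overline{\gamma_t(\xi,|\eta|)}e^{i\langle\eta,x-y\rangle}d\xi d\eta,$$ where $c_H>0$ is a constant, $D_n:=\{(\xi,\eta)\in\mathbb R\times\mathbb R^d:\ |\xi|\le2^{2n},\ |\eta|\le2^n\}$ and $\gamma_t(\xi,r):=e^{i\xi t}\int_0^te^{-sr^2}e^{-i\xi s}ds$. The Wick-renormalized square is $\Psi^{\diamond2}_n(t,x):=\Psi_n(t,x)^2-\mathbb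 E[\Psi_n(t,x)^2]$. *)

theory Defs
  imports "HOL-Probability.Probability"
begin

definition partial_derivative ::
    "'d \<Rightarrow> (real^'d \<Rightarrow> 'b::real_normed_vector) \<Rightarrow> real^'d \<Rightarrow> 'b" where
  "partial_derivative i f x = frechet_derivative f (at x) (axis i 1)"

definition iterated_partial_derivative ::
    "'d list \<Rightarrow> (real^'d \<Rightarrow> 'b::real_normed_vector) \<Rightarrow> real^'d \<Rightarrow> 'b" where
  "iterated_partial_derivative js f = foldr partial_derivative js f"

text \<open>Requiring every iterated partial derivative to be totally differentiable is the same as
  requiring all partial derivatives of all orders to exist and be continuous.\<close>

definition smooth_function :: "(real^'d \<Rightarrow> 'b::real_normed_vector) \<Rightarrow> bool" where
  "smooth_function f \<longleftrightarrow>
     (\<forall>js x. iterated_partial_derivative js f differentiable (at x))"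

definition compactly_supported :: "(real^'d \<Rightarrow> 'b::real_normed_vector) \<Rightarrow> bool" where
  "compactly_supported f \<longleftrightarrow> compact (closure {x. f x \<noteq> 0})"

definition schwartz_function :: "(real^'d \<Rightarrow> complex) \<Rightarrow> bool" where
  "schwartz_function \<phi> \<longleftrightarrow> smooth_function \<phi> \<and>
     (\<forall>k js. \<exists>C. \<forall>x. norm x ^ k * norm (iterated_partial_derivative js \<phi> x) \<le> C)"

definition fourier :: "(real^'d \<Rightarrow> complex) \<Rightarrow> real^'d \<Rightarrow> complex" where
  "fourier f \<xi> = (LINT x|lborel. cis (- (x \<bullet> \<xi>)) * f x)"

definition inverse_fourier :: "(real^'d \<Rightarrow> complex) \<Rightarrow> real^'d \<Rightarrow> complex" where
  "inverse_fourier f x =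
     complex_of_real (1 / (2 * pi) ^ CARD('d)) * (LINT \<xi>|lborel. cis (x \<bullet> \<xi>) * f \<xi>)"

text \<open>A tempered distribution is represented by a functional that is only ever evaluated at
  Schwartz functions. The Fourier transform, its inverse and multiplication by a smooth function of
  polynomial growth act on distributions by duality. The pairing is bilinear (no complex
  conjugation), so each of these operations extends the one on functions.\<close>

type_synonym 'd distribution = "(real^'d \<Rightarrow> complex) \<Rightarrow> complex"

definition distribution_of :: "(real^'d \<Rightarrow> complex) \<Rightarrow> ('d::finite) distribution" where
  "distribution_of f \<phi> = (LINT x|lborel. f x * \<phi> x)"

definition fourier_distribution :: "('d::finite) distribution \<Rightarrow> 'd distribution" where
  "fourier_distribution u \<phi> = u (fourier \<phi>)"

definition inverse_fourier_distribution ::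
    "('d::finite) distribution \<Rightarrow> 'd distribution" where
  "inverse_fourier_distribution u \<phi> = u (inverse_fourier \<phi>)"

definition mult_distribution ::
    "(real^'d \<Rightarrow> real) \<Rightarrow> ('d::finite) distribution \<Rightarrow> 'd distribution" where
  "mult_distribution m u \<phi> = u (\<lambda>\<xi>. complex_of_real (m \<xi>) * \<phi> \<xi>)"

definition bessel_potential ::
    "real \<Rightarrow> ('d::finite) distribution \<Rightarrow> 'd distribution" where
  "bessel_potential s u =
     inverse_fourier_distribution
       (mult_distribution (\<lambda>\<xi>. (1 + (norm \<xi>)\<^sup>2) powr (s / 2)) (fourier_distribution u))"

definition square_integrable :: "(real^'d \<Rightarrow> complex) \<Rightarrow> bool" where
  "square_integrable g \<longleftrightarrow>
     g \<in> borel_measurable lborel \<and> integrable lborel (\<lambda>x. (norm (g x))\<^sup>2)"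

definition L2_norm :: "(real^'d \<Rightarrow> complex) \<Rightarrow> real" where
  "L2_norm g = sqrt (LINT x|lborel. (norm (g x))\<^sup>2)"

text \<open>The \<open>L\<^sup>2\<close> norm of a distribution is that of the function representing it, and infinite
  if there is none. The representing function is unique up to a null set, so the infimum ranges
  over at most one value; it is infinite when the index set is empty.\<close>

definition L2_norm_distribution :: "('d::finite) distribution \<Rightarrow> ennreal" where
  "L2_norm_distribution u =
     (INF g\<in>{g. square_integrable g \<and> (\<forall>\<phi>. schwartz_function \<phi> \<longrightarrow> u \<phi> = distribution_of g \<phi>)}.
        ennreal (L2_norm g))"

definition sobolev_norm :: "real \<Rightarrow> (real^'d \<Rightarrow> complex) \<Rightarrow> ennreal" where
  "sobolev_norm s f = L2_norm_distribution (bessel_potential s (distribution_of f))"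

text \<open>Constants count as (degenerate) Gaussian random variables.\<close>

definition gaussian_rv :: "'w measure \<Rightarrow> ('w \<Rightarrow> real) \<Rightarrow> bool" where
  "gaussian_rv M Y \<longleftrightarrow> Y \<in> borel_measurable M \<and>
     (\<exists>\<mu>. (AE \<omega> in M. Y \<omega> = \<mu>) \<or>
          (\<exists>\<sigma>>0. distributed M lborel Y (\<lambda>y. ennreal (normal_density \<mu> \<sigma> y))))"

definition centered_gaussian_process ::
    "'w measure \<Rightarrow> 'i set \<Rightarrow> ('i \<Rightarrow> 'w \<Rightarrow> real) \<Rightarrow> bool" where
  "centered_gaussian_process M I X \<longleftrightarrow>
     (\<forall>i\<in>I. X i \<in> borel_measurable M \<and> (LINT \<omega>|M. X i \<omega>) = 0) \<and>
     (\<forall>J a. finite J \<and> J \<subseteq> I \<longrightarrow> gaussian_rv M (\<lambda>\<omega>. \<Sum>j\<in>J. a j * X j \<omega>))"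

definition gamma_kernel :: "real \<Rightarrow> real \<Rightarrow> real \<Rightarrow> complex" where
  "gamma_kernel t \<xi> r =
     cis (\<xi> * t) * (LINT s:{0..t}|lborel. complex_of_real (exp (- s * r\<^sup>2)) * cis (- \<xi> * s))"

definition D_set :: "nat \<Rightarrow> (real \<times> (real^'d)) set" where
  "D_set n = {(\<xi>, \<eta>). \<bar>\<xi>\<bar> \<le> 2 ^ (2 * n) \<and> norm \<eta> \<le> 2 ^ n}"

definition psi_covariance ::
    "real \<Rightarrow> real \<Rightarrow> real^'d \<Rightarrow> nat \<Rightarrow> real \<Rightarrow> real^'d \<Rightarrow> nat \<Rightarrow> real \<Rightarrow> real^'d \<Rightarrow> complex" where
  "psi_covariance c H0 H n s x m t y =
     complex_of_real (c\<^sup>2) *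
     (LINT p:D_set n \<inter> D_set m|lborel.
        (case p of (\<xi>, \<eta>) \<Rightarrow>
           complex_of_real (1 / \<bar>\<xi>\<bar> powr (2 * H0 - 1) *
                            (\<Prod>i\<in>UNIV. 1 / \<bar>\<eta> $ i\<bar> powr (2 * H $ i - 1))) *
           gamma_kernel s \<xi> (norm \<eta>) * cnj (gamma_kernel t \<xi> (norm \<eta>)) *
           cis (\<eta> \<bullet> (x - y))))"

definition psi_process ::
    "'w measure \<Rightarrow> real \<Rightarrow> real \<Rightarrow> real^'d \<Rightarrow> (nat \<Rightarrow> real \<Rightarrow> real^'d \<Rightarrow> 'w \<Rightarrow> real) \<Rightarrow> bool" where
  "psi_process M c H0 H \<Psi> \<longleftrightarrow>
     centered_gaussian_process M {(n, s, x). n \<ge> 1 \<and> s \<ge> 0} (\<lambda>(n, s, x). \<Psi> n s x) \<and>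
     (\<forall>n\<ge>1. \<forall>\<omega>\<in>space M. continuous_on ({0..} \<times> UNIV) (\<lambda>(s, x). \<Psi> n s x \<omega>)) \<and>
     (\<forall>n\<ge>1. \<forall>m\<ge>1. \<forall>s\<ge>0. \<forall>t\<ge>0. \<forall>x y.
        complex_of_real (LINT \<omega>|M. \<Psi> n s x \<omega> * \<Psi> m t y \<omega>) = psi_covariance c H0 H n s x m t y)"

definition wick_square ::
    "'w measure \<Rightarrow> (nat \<Rightarrow> real \<Rightarrow> real^'d \<Rightarrow> 'w \<Rightarrow> real) \<Rightarrow> nat \<Rightarrow> real \<Rightarrow> real^'d \<Rightarrow> 'w \<Rightarrow> real" where
  "wick_square M \<Psi> n t x \<omega> = (\<Psi> n t x \<omega>)\<^sup>2 - (LINT \<omega>'|M. (\<Psi> n t x \<omega>')\<^sup>2)"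

end

theory Submission
  imports Defs
begin

text \<open>For any test function \<open>\<phi>\<close>, duality and the Cauchy--Schwarz inequality bound the norm of
  \<open>\<rho> \<Psi>\<^sub>n\<^sup>\<diamond>\<^sup>2(t, \<cdot>)\<close> in \<open>H\<^sup>-\<^sup>2\<^sup>\<alpha>\<close> from below by \<open>\<bar>\<integral> g(x) \<Psi>\<^sub>n\<^sup>\<diamond>\<^sup>2(t, x) dx\<bar> / \<parallel>\<phi>\<parallel>\<close>, where \<open>g\<close> is \<open>\<rho>\<close> times the Bessel
  potential of \<open>\<phi>\<close>. With \<open>\<phi>\<close> a Gaussian centred where \<open>\<rho>\<close> does not vanish, \<open>g\<close> is continuous, compactly
  supported and nonzero. By Wick's formula and Fubini's theorem the second moment of the integral is
  a constant times the integral of \<open>\<bar>G(\<eta> + \<eta>')\<bar>\<^sup>2\<close> against two copies of the spectral measure of \<open>\<Psi>\<^sub>n\<close>,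
  where \<open>G\<close> is the Fourier transform of \<open>g\<close>. It increases with \<open>n\<close>, and in the limit it is infinite:
  \<open>\<bar>G\<bar>\<^sup>2\<close> is bounded below on some ball around \<open>\<zeta>\<^sub>0\<close>, and under the hypothesis on the Hurst
  parameters each dyadic block \<open>X\<^sup>2 \<le> \<xi>, \<xi>' \<le> 2X\<^sup>2\<close>, \<open>X < \<eta>\<^sub>i < 2X\<close>, \<open>\<eta>' \<approx> \<zeta>\<^sub>0 - \<eta>\<close> with \<open>X = 2\<^sup>k\<close> contributes at least
  a constant independent of \<open>k\<close>. This happens for one fixed test function, hence for every \<open>\<alpha>\<close>.\<close>

section \<open>Moments of Gaussian variables\<close>

lemma normal_density_zero_mean_moments:
  fixes \<sigma> :: real
  assumes "0 < \<sigma>"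
  shows "has_bochner_integral lborel (\<lambda>x. normal_density 0 \<sigma> x * x^2) (\<sigma>^2)"
    and "has_bochner_integral lborel (\<lambda>x. normal_density 0 \<sigma> x * x^4) (3 * \<sigma>^4)"
proof -
  show "has_bochner_integral lborel (\<lambda>x. normal_density 0 \<sigma> x * x^2) (\<sigma>^2)"
    using normal_moment_even[OF assms, of 0 1] by simp
  have "fact (2 * 2) / ((2 / \<sigma>\<^sup>2) ^ 2 * fact 2) = 3 * \<sigma>^4"
    using assms by (simp add: fact_numeral field_simps power2_eq_square power4_eq_xxxx)
  then show "has_bochner_integral lborel (\<lambda>x. normal_density 0 \<sigma> x * x^4) (3 * \<sigma>^4)"
    using normal_moment_even[OF assms, of 0 2] by simp
qed

text \<open>In the degenerate case the constant equals the mean, hence 0, and every positive power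
  vanishes almost surely. Otherwise the mean forces \<open>\<mu> = 0\<close>, and the moments are
  those of the normal density.\<close>

lemma (in prob_space) centered_gaussian_rv_moments:
  assumes "gaussian_rv M Y" and mean: "expectation Y = 0"
  shows "integrable M (\<lambda>\<omega>. (Y \<omega>)^2)" "integrable M (\<lambda>\<omega>. (Y \<omega>)^4)"
    and "expectation (\<lambda>\<omega>. (Y \<omega>)^4) = 3 * (expectation (\<lambda>\<omega>. (Y \<omega>)^2))^2"
proof -
  have [measurable]: "Y \<in> borel_measurable M"
    and cases: "\<exists>\<mu>. (AE \<omega> in M. Y \<omega> = \<mu>) \<or>
          (\<exists>\<sigma>>0. distributed M lborel Y (\<lambda>y. ennreal (normal_density \<mu> \<sigma> y)))"
    using assms(1) unfolding gaussian_rv_def by auto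
  have "integrable M (\<lambda>\<omega>. (Y \<omega>)^2) \<and> integrable M (\<lambda>\<omega>. (Y \<omega>)^4) \<and>
    expectation (\<lambda>\<omega>. (Y \<omega>)^4) = 3 * (expectation (\<lambda>\<omega>. (Y \<omega>)^2))^2"
  proof (rule exE[OF cases], elim disjE exE conjE)
    fix \<mu> assume ae: "AE \<omega> in M. Y \<omega> = \<mu>"
    have "expectation Y = expectation (\<lambda>_. \<mu>)"
      using ae by (intro integral_cong_AE) auto
    then have "\<mu> = 0"
      using mean by (simp add: prob_space)
    then have *: "AE \<omega> in M. (Y \<omega>)^k = (0::real)" if "k > 0" for k
      using ae that by auto
    have "integrable M (\<lambda>\<omega>. (Y \<omega>)^k) \<and> expectation (\<lambda>\<omega>. (Y \<omega>)^k) = 0" if "k > 0" for k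
      using integrable_cong_AE[OF _ _ *[OF that]] integral_cong_AE[OF _ _ *[OF that]] by simp
    from this[of 2] this[of 4] show ?thesis
      by simp
  next
    fix \<mu> \<sigma> :: real
    assume \<sigma>: "\<sigma> > 0" and d: "distributed M lborel Y (\<lambda>y. ennreal (normal_density \<mu> \<sigma> y))"
    have "expectation Y = \<mu>"
      using distributed_integral[OF d, of "\<lambda>x. x"] integral_normal_moment_nz_1[OF \<sigma>, of \<mu>] by simp
    then have [simp]: "\<mu> = 0"
      using mean by simp
    have m: "integrable M (\<lambda>\<omega>. (Y \<omega>)^k) \<and> expectation (\<lambda>\<omega>. (Y \<omega>)^k) = v"
      if "has_bochner_integral lborel (\<lambda>x. normal_density 0 \<sigma> x * x^k) v" for k v
      using distributed_integral[OF d, of "\<lambda>x. x^k"] distributed_integrable[OF d, of "\<lambda>x. x^k"] that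
      by (auto simp: has_bochner_integral_iff)
    show ?thesis
      using m[OF normal_density_zero_mean_moments(1)[OF \<sigma>]]
        m[OF normal_density_zero_mean_moments(2)[OF \<sigma>]]
      by (simp add: power2_eq_square power4_eq_xxxx)
  qed
  then show "integrable M (\<lambda>\<omega>. (Y \<omega>)^2)" "integrable M (\<lambda>\<omega>. (Y \<omega>)^4)"
    "expectation (\<lambda>\<omega>. (Y \<omega>)^4) = 3 * (expectation (\<lambda>\<omega>. (Y \<omega>)^2))^2"
    by auto
qed

text \<open>Wick's formula by polarization: only one-dimensional moments of \<open>X\<close>,
  \<open>Y\<close>, \<open>X + Y\<close> and \<open>X - Y\<close> enter, so no joint density is
  required and degenerate pairs are covered.\<close>

lemma (in prob_space) wick_square_covariance:
  fixes X Y :: "'a \<Rightarrow> real"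
  assumes gauss: "\<And>a b. gaussian_rv M (\<lambda>\<omega>. a * X \<omega> + b * Y \<omega>)"
    and mean: "\<And>a b. expectation (\<lambda>\<omega>. a * X \<omega> + b * Y \<omega>) = 0"
  defines "W \<equiv> (\<lambda>Z \<omega>. (Z \<omega>)^2 - expectation (\<lambda>\<omega>. (Z \<omega>)^2))"
  shows "integrable M (\<lambda>\<omega>. W X \<omega> * W Y \<omega>)"
    and "expectation (\<lambda>\<omega>. W X \<omega> * W Y \<omega>) = 2 * (expectation (\<lambda>\<omega>. X \<omega> * Y \<omega>))^2"
proof -
  let ?E = expectation
  note m = centered_gaussian_rv_moments[OF gauss mean]
  have X2: "integrable M (\<lambda>\<omega>. X \<omega> ^2)" and X4: "integrable M (\<lambda>\<omega>. X \<omega> ^4)"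
    and EX4: "?E (\<lambda>\<omega>. X \<omega> ^4) = 3 * (?E (\<lambda>\<omega>. X \<omega>^2))^2" using m[of 1 0] by simp_all
  have Y2: "integrable M (\<lambda>\<omega>. Y \<omega> ^2)" and Y4: "integrable M (\<lambda>\<omega>. Y \<omega> ^4)"
    and EY4: "?E (\<lambda>\<omega>. Y \<omega> ^4) = 3 * (?E (\<lambda>\<omega>. Y \<omega>^2))^2" using m[of 0 1] by simp_all
  have P2: "integrable M (\<lambda>\<omega>. (X \<omega> + Y \<omega>) ^2)" and P4: "integrable M (\<lambda>\<omega>. (X \<omega> + Y \<omega>) ^4)"
    and EP4: "?E (\<lambda>\<omega>. (X \<omega> + Y \<omega>) ^4) = 3 * (?E (\<lambda>\<omega>. (X \<omega> + Y \<omega>)^2))^2"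
    using m[of 1 1] by simp_all
  have Q2: "integrable M (\<lambda>\<omega>. (X \<omega> - Y \<omega>) ^2)" and Q4: "integrable M (\<lambda>\<omega>. (X \<omega> - Y \<omega>) ^4)"
    and EQ4: "?E (\<lambda>\<omega>. (X \<omega> - Y \<omega>) ^4) = 3 * (?E (\<lambda>\<omega>. (X \<omega> - Y \<omega>)^2))^2"
    using m[of 1 "-1"] by simp_all
  have XYeq: "(\<lambda>\<omega>. X \<omega> * Y \<omega>) = (\<lambda>\<omega>. ((X \<omega> + Y \<omega>)^2 - (X \<omega> - Y \<omega>)^2) / 4)"
    by (auto simp: power2_eq_square algebra_simps)
  have XY: "integrable M (\<lambda>\<omega>. X \<omega> * Y \<omega>)"
    unfolding XYeq using P2 Q2 by auto
  have EP2: "?E (\<lambda>\<omega>. (X \<omega> + Y \<omega>)^2) = ?E (\<lambda>\<omega>. X \<omega>^2) + ?E (\<lambda>\<omega>. Y \<omega>^2) + 2 * ?E (\<lambda>\<omega>. X \<omega> * Y \<omega>)"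
    using X2 Y2 XY by (simp add: power2_sum mult.assoc)
  have EQ2: "?E (\<lambda>\<omega>. (X \<omega> - Y \<omega>)^2) = ?E (\<lambda>\<omega>. X \<omega>^2) + ?E (\<lambda>\<omega>. Y \<omega>^2) - 2 * ?E (\<lambda>\<omega>. X \<omega> * Y \<omega>)"
    using X2 Y2 XY by (simp add: power2_diff mult.assoc)
  \<comment> \<open>The odd mixed terms cancel:
    \<open>(X + Y)^4 + (X - Y)^4 = 2 X^4 + 12 X^2 Y^2 + 2 Y^4\<close>.\<close>
  have X2Y2eq: "(\<lambda>\<omega>. X \<omega>^2 * Y \<omega>^2) =
      (\<lambda>\<omega>. ((X \<omega> + Y \<omega>)^4 + (X \<omega> - Y \<omega>)^4 - 2 * X \<omega>^4 - 2 * Y \<omega>^4) / 12)"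
    by (auto simp: power2_eq_square power4_eq_xxxx algebra_simps)
  have X2Y2: "integrable M (\<lambda>\<omega>. X \<omega>^2 * Y \<omega>^2)"
    unfolding X2Y2eq using P4 Q4 X4 Y4 by auto
  have "?E (\<lambda>\<omega>. X \<omega>^2 * Y \<omega>^2) =
      (?E (\<lambda>\<omega>. (X \<omega> + Y \<omega>)^4) + ?E (\<lambda>\<omega>. (X \<omega> - Y \<omega>)^4)
        - 2 * ?E (\<lambda>\<omega>. X \<omega>^4) - 2 * ?E (\<lambda>\<omega>. Y \<omega>^4)) / 12"
    unfolding X2Y2eq using P4 Q4 X4 Y4 by simp
  also have "\<dots> = ?E (\<lambda>\<omega>. X \<omega>^2) * ?E (\<lambda>\<omega>. Y \<omega>^2) + 2 * (?E (\<lambda>\<omega>. X \<omega> * Y \<omega>))^2"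
    unfolding EP4 EQ4 EX4 EY4 EP2 EQ2 by (simp add: power2_eq_square algebra_simps)
  finally have E22: "?E (\<lambda>\<omega>. X \<omega>^2 * Y \<omega>^2) =
    ?E (\<lambda>\<omega>. X \<omega>^2) * ?E (\<lambda>\<omega>. Y \<omega>^2) + 2 * (?E (\<lambda>\<omega>. X \<omega> * Y \<omega>))^2" .
  have Weq: "(\<lambda>\<omega>. W X \<omega> * W Y \<omega>) = (\<lambda>\<omega>. X \<omega>^2 * Y \<omega>^2 - ?E (\<lambda>\<omega>. Y \<omega>^2) * X \<omega>^2
      - ?E (\<lambda>\<omega>. X \<omega>^2) * Y \<omega>^2 + ?E (\<lambda>\<omega>. X \<omega>^2) * ?E (\<lambda>\<omega>. Y \<omega>^2))"
    by (auto simp: W_def algebra_simps)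
  show "integrable M (\<lambda>\<omega>. W X \<omega> * W Y \<omega>)"
    unfolding Weq using X2Y2 X2 Y2 by auto
  show "?E (\<lambda>\<omega>. W X \<omega> * W Y \<omega>) = 2 * (?E (\<lambda>\<omega>. X \<omega> * Y \<omega>))^2"
    unfolding Weq using X2Y2 X2 Y2 E22 by (simp add: prob_space)
qed

section \<open>Gaussians and their Fourier transform\<close>

text \<open>\<open>lborel\<close> on vectors is the image of a product measure indexed by
  \<open>Basis\<close>; reindexing along \<open>axis\<close> turns products over the basis into
  products over the coordinates, where Fubini's theorem for finite products applies.\<close>

lemma lborel_vec_prod:
  fixes f :: "'d::finite \<Rightarrow> real \<Rightarrow> 'b::{real_normed_field,banach,second_countable_topology}"
  assumes f: "\<And>i. integrable lborel (f i)"
  shows "integrable lborel (\<lambda>x::real^'d. \<Prod>i\<in>UNIV. f i (x $ i))"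
    and "(LINT x|lborel. (\<Prod>i\<in>UNIV. f i ((x::real^'d) $ i))) = (\<Prod>i\<in>UNIV. (LINT y|lborel. f i y))"
proof -
  interpret product_sigma_finite "\<lambda>_::real^'d. lborel :: real measure" ..
  let ?T = "\<lambda>g. \<Sum>b\<in>Basis. g b *\<^sub>R b :: real^'d"
  let ?P = "\<Pi>\<^sub>M b\<in>(Basis :: (real^'d) set). (lborel :: real measure)"
  have [measurable]: "f i \<in> borel_measurable borel" for i
    using borel_measurable_integrable[OF f[of i]] by simp
  have bij: "bij_betw (\<lambda>i. axis i 1 :: real^'d) UNIV Basis"
    by (auto simp: bij_betw_def inj_on_def axis_eq_axis Basis_vec_def)
  have prod_eq: "(\<Prod>b\<in>Basis. h (axis_index (b :: real^'d)) b) = (\<Prod>i\<in>UNIV. h i (axis i 1))"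
    for h :: "'d \<Rightarrow> real^'d \<Rightarrow> 'b"
    by (subst prod.reindex_bij_betw[OF bij, symmetric]) (simp add: axis_index_axis)
  have eq: "(\<Prod>i\<in>UNIV. f i (?T g $ i)) = (\<Prod>b\<in>Basis. f (axis_index b) (g b))" for g
    unfolding prod_eq[of "\<lambda>i b. f i (g b)"]
    by (simp add: cart_eq_inner_axis inner_sum_left_Basis axis_in_Basis_iff)
  have T [measurable]: "?T \<in> borel_measurable ?P"
    by measurable
  have F [measurable]: "(\<lambda>x::real^'d. \<Prod>i\<in>UNIV. f i (x $ i)) \<in> borel_measurable borel"
    by measurable
  show "integrable lborel (\<lambda>x::real^'d. \<Prod>i\<in>UNIV. f i (x $ i))"
    by (subst lborel_eq, subst integrable_distr_eq[OF T F], unfold eq)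
       (intro product_integrable_prod f, simp)
  have "(LINT x|lborel. (\<Prod>i\<in>UNIV. f i ((x::real^'d) $ i))) =
      (\<Prod>b\<in>(Basis :: (real^'d) set). (LINT y|lborel. f (axis_index b) y))"
    by (subst lborel_eq, subst integral_distr[OF T F], unfold eq)
       (intro product_integral_prod f, simp)
  then show "(LINT x|lborel. (\<Prod>i\<in>UNIV. f i ((x::real^'d) $ i))) = (\<Prod>i\<in>UNIV. (LINT y|lborel. f i y))"
    unfolding prod_eq[of "\<lambda>i b. LINT y|lborel. f i y"] .
qed

text \<open>Up to the factor \<open>sqrt (2 * pi)\<close> this is the characteristic function of the
  standard normal distribution.\<close>

lemma gaussian_fourier_real:
  fixes \<theta> :: real
  shows "integrable lborel (\<lambda>y. cis (\<theta> * y) * complex_of_real (exp (- y\<^sup>2 / 2)))"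
    and "(LINT y|lborel. cis (\<theta> * y) * complex_of_real (exp (- y\<^sup>2 / 2))) =
      complex_of_real (sqrt (2 * pi) * exp (- \<theta>\<^sup>2 / 2))"
proof -
  have [measurable]: "cis \<in> borel_measurable borel"
    by (intro borel_measurable_continuous_onI continuous_intros)
  have eq: "(\<lambda>y. cis (\<theta> * y) * complex_of_real (exp (- y\<^sup>2 / 2))) =
      (\<lambda>y. complex_of_real (sqrt (2 * pi)) * (std_normal_density y *\<^sub>R cis (\<theta> * y)))"
    by (auto simp: std_normal_density_def scaleR_conv_of_real field_simps real_sqrt_mult
      simp flip: of_real_mult)
  have "integrable lborel (\<lambda>y. std_normal_density y *\<^sub>R cis (\<theta> * y))"
    by (rule Bochner_Integration.integrable_bound[OF integrable_normal_density[of 1 0]]) auto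
  then show "integrable lborel (\<lambda>y. cis (\<theta> * y) * complex_of_real (exp (- y\<^sup>2 / 2)))"
    unfolding eq by (intro integrable_mult_right)
  have "(LINT y|lborel. std_normal_density y *\<^sub>R cis (\<theta> * y)) = char std_normal_distribution \<theta>"
    unfolding char_def by (subst integral_density) (auto simp: cis_conv_exp)
  then show "(LINT y|lborel. cis (\<theta> * y) * complex_of_real (exp (- y\<^sup>2 / 2))) =
      complex_of_real (sqrt (2 * pi) * exp (- \<theta>\<^sup>2 / 2))"
    unfolding eq integral_mult_right_zero by (simp add: char_std_normal_distribution)
qed

text \<open>Both the character and the Gaussian factor over the coordinates, which reduces the claim
  to dimension one.\<close>

lemma gaussian_fourier:
  fixes \<theta> :: "real^'d"
  shows "integrable lborel (\<lambda>y. cis (\<theta> \<bullet> y) * complex_of_real (exp (- (norm y)\<^sup>2 / 2)))"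
    and "(LINT y|lborel. cis (\<theta> \<bullet> y) * complex_of_real (exp (- (norm y)\<^sup>2 / 2))) =
      complex_of_real (sqrt (2 * pi) ^ CARD('d) * exp (- (norm \<theta>)\<^sup>2 / 2))"
proof -
  have cis: "cis (\<theta> \<bullet> y) = (\<Prod>i\<in>UNIV. cis (\<theta> $ i * y $ i))" for y
    by (simp add: cis_conv_exp inner_vec_def sum_distrib_left exp_sum)
  have exp: "exp (- (norm y)\<^sup>2 / 2) = (\<Prod>i\<in>UNIV. exp (- (y $ i)\<^sup>2 / 2))" for y :: "real^'d"
  proof -
    have "(norm y)\<^sup>2 = (\<Sum>i\<in>UNIV. (y $ i)\<^sup>2)"
      by (simp add: norm_vec_def L2_set_def sum_nonneg)
    then have "- (norm y)\<^sup>2 / 2 = (\<Sum>i\<in>UNIV. - (y $ i)\<^sup>2 / 2)"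
      by (simp add: sum_negf sum_divide_distrib)
    then show ?thesis
      by (simp add: exp_sum)
  qed
  have eq: "(\<lambda>y. cis (\<theta> \<bullet> y) * complex_of_real (exp (- (norm y)\<^sup>2 / 2))) =
     (\<lambda>y. \<Prod>i\<in>UNIV. cis (\<theta> $ i * y $ i) * complex_of_real (exp (- (y $ i)\<^sup>2 / 2)))"
    by (simp only: cis exp of_real_prod prod.distrib)
  note int = gaussian_fourier_real(1)[of "\<theta> $ _"]
  show "integrable lborel (\<lambda>y. cis (\<theta> \<bullet> y) * complex_of_real (exp (- (norm y)\<^sup>2 / 2)))"
    unfolding eq by (rule lborel_vec_prod(1)[OF int])
  show "(LINT y|lborel. cis (\<theta> \<bullet> y) * complex_of_real (exp (- (norm y)\<^sup>2 / 2))) =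
      complex_of_real (sqrt (2 * pi) ^ CARD('d) * exp (- (norm \<theta>)\<^sup>2 / 2))"
    unfolding eq lborel_vec_prod(2)[OF int] gaussian_fourier_real(2) exp[of \<theta>]
    by (simp add: prod.distrib)
qed

lemma integrable_gaussian:
  "integrable lborel (\<lambda>y::real^'d. exp (- (norm y)\<^sup>2 / 2))"
  using integrable_norm[OF gaussian_fourier(1)[of 0]] by (simp add: norm_mult)

lemma integral_lborel_translate:
  fixes f :: "'a::euclidean_space \<Rightarrow> 'b::{banach, second_countable_topology}"
  assumes "f \<in> borel_measurable borel"
  shows "(LINT y|lborel. f (c + y)) = (LINT y|lborel. f y)"
  by (subst lborel_distr_plus[of c, symmetric], subst integral_distr) (use assms in auto)

section \<open>The Gaussian test function and its Schwartz property\<close>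

definition gaussian_at :: "real^'d \<Rightarrow> real^'d \<Rightarrow> complex" where
  "gaussian_at x0 x = complex_of_real (exp (- (norm (x - x0))\<^sup>2 / 2))"

text \<open>Translation by \<open>x0\<close> moves the centre to the origin at the price of the
  phase \<open>cis (x0 \<bullet> \<xi>)\<close>.\<close>

lemma inverse_fourier_gaussian_at:
  "inverse_fourier (gaussian_at x0) \<xi> = cis (x0 \<bullet> \<xi>) *
     complex_of_real (1 / (2 * pi) ^ CARD('d) * (sqrt (2 * pi) ^ CARD('d) * exp (- (norm \<xi>)\<^sup>2 / 2)))"
  for \<xi> :: "real^'d"
proof -
  have [measurable]: "cis \<in> borel_measurable borel"
    by (intro borel_measurable_continuous_onI continuous_intros)
  have "(LINT x|lborel. cis (\<xi> \<bullet> x) * gaussian_at x0 x) =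
      (LINT y|lborel. cis (\<xi> \<bullet> (x0 + y)) * gaussian_at x0 (x0 + y))"
    by (rule integral_lborel_translate[symmetric]) (simp add: gaussian_at_def)
  also have "\<dots> = (LINT y|lborel. cis (x0 \<bullet> \<xi>) * (cis (\<xi> \<bullet> y) * complex_of_real (exp (- (norm y)\<^sup>2 / 2))))"
    by (simp add: gaussian_at_def inner_add_right cis_mult[symmetric] inner_commute mult.assoc)
  also have "\<dots> = cis (x0 \<bullet> \<xi>) * (LINT y|lborel. cis (\<xi> \<bullet> y) * complex_of_real (exp (- (norm y)\<^sup>2 / 2)))"
    by (rule integral_mult_right_zero)
  finally show ?thesis
    unfolding inverse_fourier_def gaussian_fourier(2) of_real_mult by (simp only: mult_ac)
qed

text \<open>The direction \<open>v\<close> comes before the point \<open>x\<close>, so that for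
  fixed \<open>v\<close> the derivative is again a polynomial in \<open>x\<close> and
  differentiation can be iterated.\<close>

lemma real_polynomial_function_has_derivative:
  assumes "real_polynomial_function p"
  shows "\<exists>p'. (\<forall>x. (p has_derivative (\<lambda>v. p' v x)) (at x)) \<and> (\<forall>v. real_polynomial_function (p' v))"
  using assms
proof induction
  case (linear f)
  then show ?case
    by (intro exI[of _ "\<lambda>v x. f v"]) (auto intro: bounded_linear_imp_has_derivative)
next
  case (const c)
  show ?case
    by (intro exI[of _ "\<lambda>v x. 0"]) auto
next
  case (add f g)
  then obtain f' g' where "\<forall>x. (f has_derivative (\<lambda>v. f' v x)) (at x)" "\<forall>v. real_polynomial_function (f' v)"
    "\<forall>x. (g has_derivative (\<lambda>v. g' v x)) (at x)" "\<forall>v. real_polynomial_function (g' v)"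
    by blast
  then show ?case
    by (intro exI[of _ "\<lambda>v x. f' v x + g' v x"]) (auto intro: has_derivative_add)
next
  case (mult f g)
  then obtain f' g' where "\<forall>x. (f has_derivative (\<lambda>v. f' v x)) (at x)" "\<forall>v. real_polynomial_function (f' v)"
    "\<forall>x. (g has_derivative (\<lambda>v. g' v x)) (at x)" "\<forall>v. real_polynomial_function (g' v)"
    by blast
  then show ?case
    using mult.hyps by (intro exI[of _ "\<lambda>v x. f x * g' v x + f' v x * g x"]) 
      (auto intro!: has_derivative_mult
        real_polynomial_function.intros(3)[OF real_polynomial_function.intros(4) real_polynomial_function.intros(4)])
qed

lemma real_polynomial_function_growth:
  assumes "real_polynomial_function p"
  shows "\<exists>C N. 0 \<le> C \<and> (\<forall>x. \<bar>p x\<bar> \<le> C * (1 + norm x) ^ N)"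
  using assms
proof induction
  case (linear f)
  obtain K where K: "K > 0" "\<And>x. norm (f x) \<le> norm x * K"
    using bounded_linear.pos_bounded[OF linear] by blast
  have "\<bar>f x\<bar> \<le> K * (1 + norm x) ^ 1" for x
  proof -
    have "\<bar>f x\<bar> \<le> norm x * K"
      using K(2)[of x] by simp
    also have "\<dots> \<le> K * (1 + norm x) ^ 1"
      using K(1) by (simp add: algebra_simps)
    finally show ?thesis .
  qed
  then show ?case
    using K(1) by (intro exI[of _ K] exI[of _ 1]) auto
next
  case (const c)
  show ?case
    by (intro exI[of _ "\<bar>c\<bar>"] exI[of _ 0]) auto
next
  case (add f g)
  then obtain C N D L where *: "0 \<le> C" "\<And>x. \<bar>f x\<bar> \<le> C * (1 + norm x) ^ N"
    "0 \<le> D" "\<And>x. \<bar>g x\<bar> \<le> D * (1 + norm x) ^ L"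
    by blast
  have "\<bar>f x + g x\<bar> \<le> (C + D) * (1 + norm x) ^ (N + L)" for x
  proof -
    have "\<bar>f x + g x\<bar> \<le> C * (1 + norm x) ^ N + D * (1 + norm x) ^ L"
      using *(2)[of x] *(4)[of x] by linarith
    also have "\<dots> \<le> C * (1 + norm x) ^ (N + L) + D * (1 + norm x) ^ (N + L)"
      using *(1,3) by (intro add_mono mult_left_mono power_increasing) auto
    finally show ?thesis
      by (simp add: distrib_right)
  qed
  then show ?case
    using *(1,3) by (intro exI[of _ "C + D"] exI[of _ "N + L"]) auto
next
  case (mult f g)
  then obtain C N D L where *: "0 \<le> C" "\<And>x. \<bar>f x\<bar> \<le> C * (1 + norm x) ^ N"
    "0 \<le> D" "\<And>x. \<bar>g x\<bar> \<le> D * (1 + norm x) ^ L"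
    by blast
  have "\<bar>f x * g x\<bar> \<le> (C * D) * (1 + norm x) ^ (N + L)" for x
  proof -
    have "\<bar>f x * g x\<bar> \<le> (C * (1 + norm x) ^ N) * (D * (1 + norm x) ^ L)"
      unfolding abs_mult using *(1)  by (intro mult_mono * mult_nonneg_nonneg) auto
    then show ?thesis
      by (simp add: power_add mult_ac)
  qed
  then show ?case
    using *(1,3) by (intro exI[of _ "C * D"] exI[of _ "N + L"]) auto
qed

text \<open>With \<open>r = norm (x - x0)\<close>, the base \<open>1 + norm x\<close> is at most
  \<open>exp (1 + norm x0 + r)\<close>, and completing the square gives
  \<open>N * r - r^2 / 2 \<le> N^2 / 2\<close>.\<close>

lemma power_times_gaussian_bounded:
  fixes x0 :: "real^'d"
  shows "(1 + norm x) ^ N * exp (- (norm (x - x0))\<^sup>2 / 2) \<le> exp (real N * (1 + norm x0) + (real N)\<^sup>2 / 2)"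
proof -
  define r where "r = norm (x - x0)"
  have "norm x \<le> norm x0 + r"
    unfolding r_def using norm_triangle_sub[of x x0] by simp
  also have "1 + (norm x0 + r) \<le> exp (norm x0 + r)"
    using exp_ge_add_one_self[of "norm x0 + r"] by simp
  finally have "1 + norm x \<le> exp (1 + norm x0 + r)"
    by (smt (verit) exp_less_cancel_iff)
  then have "(1 + norm x) ^ N \<le> exp (real N * (1 + norm x0 + r))"
    using power_mono[of "1 + norm x" "exp (1 + norm x0 + r)" N] by (simp add: exp_of_nat_mult)
  then have "(1 + norm x) ^ N * exp (- r\<^sup>2 / 2) \<le> exp (real N * (1 + norm x0 + r)) * exp (- r\<^sup>2 / 2)"
    by (intro mult_right_mono) auto
  also have "\<dots> = exp (real N * (1 + norm x0 + r) - r\<^sup>2 / 2)"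
    by (simp add: exp_add[symmetric])
  also have "\<dots> \<le> exp (real N * (1 + norm x0) + (real N)\<^sup>2 / 2)"
    using zero_le_power2[of "r - real N"] by (simp add: power2_diff algebra_simps)
  finally show ?thesis
    by (simp add: r_def)
qed

text \<open>Polynomials times the Gaussian are closed under partial derivatives, so every iterated
  derivative has this form; polynomial growth against Gaussian decay then bounds all Schwartz
  seminorms.\<close>

lemma schwartz_gaussian_at: "schwartz_function (gaussian_at x0)"
  for x0 :: "real^'d"
proof -
  let ?G = "\<lambda>x. exp (- (norm (x - x0))\<^sup>2 / 2)"
  have G: "?G = (\<lambda>x. exp (- ((x - x0) \<bullet> (x - x0)) / 2))"
    by (simp add: power2_norm_eq_inner)
  have dG: "(?G has_derivative (\<lambda>v. - ((x - x0) \<bullet> v) * ?G x)) (at x)" for x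
    unfolding G by (rule derivative_eq_intros refl | simp add: inner_commute fun_eq_iff power2_norm_eq_inner)+
  have deriv: "\<exists>q. (\<forall>x. ((\<lambda>x. complex_of_real (p x * ?G x)) has_derivative
        (\<lambda>v. complex_of_real (q v x * ?G x))) (at x)) \<and> (\<forall>v. real_polynomial_function (q v))"
    if p: "real_polynomial_function p" for p
  proof -
    obtain p' where p': "\<And>x. (p has_derivative (\<lambda>v. p' v x)) (at x)"
      "\<And>v. real_polynomial_function (p' v)"
      using real_polynomial_function_has_derivative[OF p] by blast
    have "real_polynomial_function (\<lambda>x. p' v x - p x * ((x - x0) \<bullet> v))" for v
      by (intro real_polynomial_function_diff p' real_polynomial_function.intros(4) p)
        (simp add: inner_diff_left real_polynomial_function.intros
          real_polynomial_function_diff bounded_linear_inner_left)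
    moreover have "((\<lambda>x. complex_of_real (p x * ?G x)) has_derivative
        (\<lambda>v. complex_of_real ((p' v x - p x * ((x - x0) \<bullet> v)) * ?G x))) (at x)" for x
      by (rule has_derivative_eq_rhs[OF has_derivative_of_real[OF has_derivative_mult[OF p'(1) dG]]])
        (simp add: fun_eq_iff algebra_simps)
    ultimately show ?thesis
      by (intro exI[of _ "\<lambda>v x. p' v x - p x * ((x - x0) \<bullet> v)"]) auto
  qed
  have iter: "\<exists>p. real_polynomial_function p \<and>
      iterated_partial_derivative js (gaussian_at x0) = (\<lambda>x. complex_of_real (p x * ?G x))" for js
  proof (induction js)
    case Nil
    show ?case
      by (intro exI[of _ "\<lambda>_. 1"])
        (auto simp: iterated_partial_derivative_def gaussian_at_def fun_eq_iff)
  next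
    case (Cons j js)
    then obtain p where p: "real_polynomial_function p"
      "iterated_partial_derivative js (gaussian_at x0) = (\<lambda>x. complex_of_real (p x * ?G x))"
      by blast
    obtain q where q: "\<And>x. ((\<lambda>x. complex_of_real (p x * ?G x)) has_derivative
        (\<lambda>v. complex_of_real (q v x * ?G x))) (at x)" "\<And>v. real_polynomial_function (q v)"
      using deriv[OF p(1)] by blast
    have "iterated_partial_derivative (j # js) (gaussian_at x0) =
        partial_derivative j (iterated_partial_derivative js (gaussian_at x0))"
      by (simp add: iterated_partial_derivative_def)
    also have "\<dots> = (\<lambda>x. complex_of_real (q (axis j 1) x * ?G x))"
      unfolding p(2) partial_derivative_def fun_eq_iff frechet_derivative_at[OF q(1), symmetric] by simp
    finally show ?case
      using q(2) by blast
  qed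
  have "smooth_function (gaussian_at x0)"
    unfolding smooth_function_def
  proof (intro allI)
    fix js x
    obtain p where p: "real_polynomial_function p"
      "iterated_partial_derivative js (gaussian_at x0) = (\<lambda>x. complex_of_real (p x * ?G x))"
      using iter by blast
    show "iterated_partial_derivative js (gaussian_at x0) differentiable at x"
      using deriv[OF p(1)] unfolding p(2) differentiable_def by blast
  qed
  moreover have "\<exists>C. \<forall>x. norm x ^ k * norm (iterated_partial_derivative js (gaussian_at x0) x) \<le> C" for k js
  proof -
    obtain p where p: "real_polynomial_function p"
      "iterated_partial_derivative js (gaussian_at x0) = (\<lambda>x. complex_of_real (p x * ?G x))"
      using iter by blast
    obtain C N where C: "0 \<le> C" "\<And>x. \<bar>p x\<bar> \<le> C * (1 + norm x) ^ N"
      using real_polynomial_function_growth[OF p(1)] by blast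
    have "norm x ^ k * norm (iterated_partial_derivative js (gaussian_at x0) x)
        \<le> C * exp (real (k + N) * (1 + norm x0) + (real (k + N))\<^sup>2 / 2)" for x
    proof -
      have "norm x ^ k * norm (iterated_partial_derivative js (gaussian_at x0) x) =
          norm x ^ k * \<bar>p x\<bar> * ?G x"
        unfolding p(2) norm_of_real by (simp add: abs_mult)
      also have "\<dots> \<le> (1 + norm x) ^ k * (C * (1 + norm x) ^ N) * ?G x"
        using C by (intro mult_right_mono mult_mono power_mono) auto
      also have "\<dots> = C * ((1 + norm x) ^ (k + N) * ?G x)"
        by (simp add: power_add)
      also have "\<dots> \<le> C * exp (real (k + N) * (1 + norm x0) + (real (k + N))\<^sup>2 / 2)"
        using C(1) by (intro mult_left_mono power_times_gaussian_bounded)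
      finally show ?thesis .
    qed
    then show ?thesis
      by blast
  qed
  ultimately show ?thesis
    by (simp add: schwartz_function_def)
qed

lemma square_integrable_gaussian_at:
  "integrable lborel (\<lambda>x. (norm (gaussian_at x0 x))\<^sup>2)" for x0 :: "real^'d"
proof -
  have "integrable (distr lborel borel ((+) (- x0))) (\<lambda>y::real^'d. exp (- (norm y)\<^sup>2 / 2))"
    unfolding lborel_distr_plus by (rule integrable_gaussian)
  then have *: "integrable lborel (\<lambda>x::real^'d. exp (- (norm (x - x0))\<^sup>2 / 2))"
    by (subst (asm) integrable_distr_eq) auto
  \<comment> \<open>The Gaussian takes values in \<open>[0, 1]\<close>, so its square is at most the
    Gaussian itself.\<close>
  show ?thesis
  proof (rule Bochner_Integration.integrable_bound[OF *])
    show "AE x in lborel. norm ((norm (gaussian_at x0 x))\<^sup>2) \<le> norm (exp (- (norm (x - x0))\<^sup>2 / 2))"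
      by (auto simp: gaussian_at_def power2_eq_square[of "exp _"] intro!: mult_left_le_one_le)
  qed (simp add: gaussian_at_def)
qed

section \<open>Injectivity of the Fourier transform\<close>

lemma integrable_mult_cis:
  fixes k :: "'a \<Rightarrow> complex"
  assumes "integrable M k" "h \<in> borel_measurable M"
  shows "integrable M (\<lambda>x. k x * cis (h x))"
proof (rule Bochner_Integration.integrable_bound[OF assms(1)])
  have [measurable]: "k \<in> borel_measurable M" "h \<in> borel_measurable M"
    using assms by auto
  have [measurable]: "cis \<in> borel_measurable borel"
    by (intro borel_measurable_continuous_onI continuous_intros)
  show "(\<lambda>x. k x * cis (h x)) \<in> borel_measurable M"
    by measurable
qed (simp add: norm_mult)

lemma continuous_integral_cis:
  fixes k :: "real^'d \<Rightarrow> complex"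
  assumes "integrable lborel k"
  shows "continuous_on UNIV (\<lambda>\<theta>. LINT x|lborel. k x * cis (\<theta> \<bullet> x))"
  unfolding continuous_on_sequentially comp_def
proof (intro allI impI ballI, elim conjE)
  fix u :: "nat \<Rightarrow> real^'d" and \<theta> assume "u \<longlonglongrightarrow> \<theta>"
  show "(\<lambda>n. LINT x|lborel. k x * cis (u n \<bullet> x)) \<longlonglongrightarrow> (LINT x|lborel. k x * cis (\<theta> \<bullet> x))"
  proof (rule integral_dominated_convergence[where w = "\<lambda>x. norm (k x)"])
    show "(\<lambda>x. k x * cis (\<theta> \<bullet> x)) \<in> borel_measurable lborel"
      and "\<And>n. (\<lambda>x. k x * cis (u n \<bullet> x)) \<in> borel_measurable lborel"
      using integrable_mult_cis[OF assms, of "\<lambda>x. _ \<bullet> x"] by auto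
    show "AE x in lborel. (\<lambda>n. k x * cis (u n \<bullet> x)) \<longlonglongrightarrow> k x * cis (\<theta> \<bullet> x)"
      using \<open>u \<longlonglongrightarrow> \<theta>\<close> by (intro AE_I2 tendsto_intros)
  qed (use assms in \<open>auto simp: norm_mult\<close>)
qed

lemma integrable_continuous_compact_support:
  fixes g :: "real^'d \<Rightarrow> complex"
  assumes "continuous_on UNIV g" "compact S" "\<And>x. x \<notin> S \<Longrightarrow> g x = 0"
  shows "integrable lborel g"
proof -
  have "integrable lborel (\<lambda>x. indicator S x *\<^sub>R g x)"
    using borel_integrable_compact[OF assms(2), of g] continuous_on_subset[OF assms(1)] by auto
  moreover have "(\<lambda>x. indicator S x *\<^sub>R g x) = g"
    using assms(3) by (auto simp: indicator_def)
  ultimately show ?thesis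
    by simp
qed

text \<open>The continuous real functions whose multiplication preserves the set of continuous
  functions supported in \<open>S\<close> with vanishing Fourier transform form an algebra that contains
  \<open>cos (\<theta> \<bullet> x)\<close> and \<open>sin (\<theta> \<bullet> x)\<close>, so the Stone--Weierstrass theorem applies to it.\<close>

lemma fourier_transform_inj:
  fixes g :: "real^'d \<Rightarrow> complex"
  assumes "continuous_on UNIV g" "compact S" "\<And>x. x \<notin> S \<Longrightarrow> g x = 0"
    and "\<And>\<theta>. (LINT x|lborel. g x * cis (\<theta> \<bullet> x)) = 0"
  shows "g x0 = 0"
proof -
  define Z where "Z = {h :: real^'d \<Rightarrow> complex. continuous_on UNIV h \<and> (\<forall>x. x \<notin> S \<longrightarrow> h x = 0) \<and>
    (\<forall>\<theta>. (LINT x|lborel. h x * cis (\<theta> \<bullet> x)) = 0)}"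
  define R where "R = {p :: real^'d \<Rightarrow> real. continuous_on UNIV p \<and>
    (\<forall>h\<in>Z. (\<lambda>x. h x * of_real (p x)) \<in> Z)}"
  have Z_int: "integrable lborel h" if "h \<in> Z" for h
    using that integrable_continuous_compact_support[OF _ assms(2)] by (auto simp: Z_def)
  have Z_int': "integrable lborel (\<lambda>x. h x * cis (\<theta> \<bullet> x))" if "h \<in> Z" for h \<theta>
    using integrable_mult_cis[OF Z_int[OF that]] by auto
  have Z_0: "(LINT x|lborel. h x * cis (\<theta> \<bullet> x)) = 0" if "h \<in> Z" for h \<theta>
    using that by (auto simp: Z_def)
  have Z_add: "(\<lambda>x. h x + k x) \<in> Z" if "h \<in> Z" "k \<in> Z" for h k
  proof -
    have "(LINT x|lborel. (h x + k x) * cis (\<theta> \<bullet> x)) = 0" for \<theta>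
      using Z_int'[of h \<theta>] Z_int'[of k \<theta>] Z_0 that by (simp add: distrib_right)
    then show ?thesis
      using that by (auto simp: Z_def intro!: continuous_intros)
  qed
  have Z_mult: "(\<lambda>x. h x * (c * cis (\<theta> \<bullet> x))) \<in> Z" if "h \<in> Z" for h \<theta> c
  proof -
    have "(LINT x|lborel. h x * (c * cis (\<theta> \<bullet> x)) * cis (\<theta>' \<bullet> x)) =
      c * (LINT x|lborel. h x * cis ((\<theta> + \<theta>') \<bullet> x))" for \<theta>'
      by (subst integral_mult_right_zero[symmetric])
        (simp add: inner_add_left cis_mult[symmetric] mult_ac)
    then show ?thesis
      using that by (auto simp: Z_def intro!: continuous_intros)
  qed
  interpret function_ring_on R S
  proof
    show "compact S" by fact
    show "continuous_on S f" if "f \<in> R" for f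
      using that continuous_on_subset by (auto simp: R_def)
    show "(\<lambda>x. f x + g x) \<in> R" if "f \<in> R" "g \<in> R" for f g
      using that Z_add by (auto simp: R_def distrib_left intro!: continuous_intros)
    show "(\<lambda>x. f x * g x) \<in> R" if "f \<in> R" "g \<in> R" for f g
    proof -
      have "(\<lambda>x. h x * complex_of_real (f x * g x)) \<in> Z" if "h \<in> Z" for h
      proof -
        have "(\<lambda>x. h x * complex_of_real (f x)) \<in> Z"
          using \<open>f \<in> R\<close> that unfolding R_def by auto
        then have "(\<lambda>x. (h x * complex_of_real (f x)) * complex_of_real (g x)) \<in> Z"
          using \<open>g \<in> R\<close> unfolding R_def by auto
        then show ?thesis
          by (simp add: mult.assoc)
      qed
      then show ?thesis
        using that by (auto simp: R_def intro!: continuous_intros)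
    qed
    show "(\<lambda>_. c) \<in> R" for c
      using Z_mult[of _ "of_real c" 0] by (auto simp: R_def)
    fix x y :: "real^'d" assume "x \<noteq> y"
    \<comment> \<open>The scaling makes the two phases differ by exactly 1, which is no multiple of
      \<open>2 * pi\<close>; hence their cosines or their sines differ.\<close>
    define \<theta> where "\<theta> = (1 / ((x - y) \<bullet> (x - y))) *\<^sub>R (x - y)"
    have \<theta>: "\<theta> \<bullet> x - \<theta> \<bullet> y = 1"
      using \<open>x \<noteq> y\<close> unfolding inner_diff_right[symmetric] by (simp add: \<theta>_def)
    have cos_eq: "complex_of_real (cos r) = 1 / 2 * cis r + 1 / 2 * cis (- r)"
      and sin_eq: "complex_of_real (sin r) = - \<i> / 2 * cis r + \<i> / 2 * cis (- r)" for r
      by (auto simp: complex_eq_iff)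
    have "(\<lambda>x. h x * complex_of_real (cos (\<theta> \<bullet> x))) \<in> Z" if "h \<in> Z" for h
      using Z_add[OF Z_mult[OF that, of "1/2" \<theta>] Z_mult[OF that, of "1/2" "-\<theta>"]]
      unfolding cos_eq distrib_left inner_minus_left .
    then have "(\<lambda>x. cos (\<theta> \<bullet> x)) \<in> R"
      by (auto simp: R_def intro!: continuous_intros)
    moreover have "(\<lambda>x. h x * complex_of_real (sin (\<theta> \<bullet> x))) \<in> Z" if "h \<in> Z" for h
      using Z_add[OF Z_mult[OF that, of "-\<i>/2" \<theta>] Z_mult[OF that, of "\<i>/2" "-\<theta>"]]
      unfolding sin_eq distrib_left inner_minus_left .
    then have "(\<lambda>x. sin (\<theta> \<bullet> x)) \<in> R"
      by (auto simp: R_def intro!: continuous_intros)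
    moreover have "cos (\<theta> \<bullet> x) \<noteq> cos (\<theta> \<bullet> y) \<or> sin (\<theta> \<bullet> x) \<noteq> sin (\<theta> \<bullet> y)"
    proof (rule ccontr)
      assume "\<not> ?thesis"
      then have "cos (\<theta> \<bullet> x - \<theta> \<bullet> y) = 1"
        by (simp add: cos_diff)
      moreover have "cos 1 < cos (0::real)"
        using pi_gt3 by (intro cos_monotone_0_pi) auto
      ultimately show False
        using \<theta> by simp
    qed
    ultimately show "\<exists>f\<in>R. f x \<noteq> f y"
      by (elim disjE) (rule bexI, assumption, assumption)+
  qed
  have g: "g \<in> Z"
    unfolding Z_def mem_Collect_eq by (intro conjI allI impI assms(1,3,4))
  have int: "integrable lborel (\<lambda>x. g x * of_real (f x))"
    if f: "continuous_on UNIV f" for f :: "real^'d \<Rightarrow> real"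
  proof (rule integrable_continuous_compact_support[of _ S])
    show "continuous_on UNIV (\<lambda>x. g x * complex_of_real (f x))"
      by (intro continuous_intros assms(1) f)
  qed (use assms(2,3) in auto)
  \<comment> \<open>Some \<open>p \<in> R\<close> approximates \<open>f\<close> uniformly on
    \<open>S\<close>, and its integral against \<open>g\<close> vanishes (frequency 0). So the
    integral with \<open>f\<close> is at most \<open>e\<close> times the L1 norm of
    \<open>g\<close>.\<close>
  have zero: "(LINT x|lborel. g x * of_real (f x)) = 0"
    if f: "continuous_on UNIV f" for f :: "real^'d \<Rightarrow> real"
  proof -
    note gf = int[OF f]
    have *: "norm (LINT x|lborel. g x * of_real (f x)) \<le> e * (LINT x|lborel. norm (g x))" if "e > 0" for e :: real
    proof -
      obtain p where p: "p \<in> R" "\<And>x. x \<in> S \<Longrightarrow> \<bar>f x - p x\<bar> < e"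
        using Stone_Weierstrass_basic[OF continuous_on_subset[OF f subset_UNIV] \<open>e > 0\<close>] by blast
      have gp: "(\<lambda>x. g x * of_real (p x)) \<in> Z"
        using g p(1) by (auto simp: R_def)
      have "(LINT x|lborel. g x * of_real (f x)) = (LINT x|lborel. g x * of_real (f x) - g x * of_real (p x))"
        using Z_int[OF gp] gf Z_0[OF gp, of 0] by simp
      also have "norm \<dots> \<le> (LINT x|lborel. norm (g x * of_real (f x) - g x * of_real (p x)))"
        by (rule integral_norm_bound)
      also have "\<dots> \<le> (LINT x|lborel. e * norm (g x))"
      proof (rule integral_mono)
        show "norm (g x * of_real (f x) - g x * of_real (p x)) \<le> e * norm (g x)" for x
        proof (cases "x \<in> S")
          case True
          have "norm (g x * of_real (f x) - g x * of_real (p x)) = \<bar>f x - p x\<bar> * norm (g x)"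
            unfolding right_diff_distrib[symmetric] of_real_diff[symmetric] norm_mult norm_of_real
            by (rule mult.commute)
          then show ?thesis
            using p(2)[OF True] by (simp add: mult_right_mono)
        qed (use assms(3) in simp)
      qed (use Z_int[OF gp] gf Z_int[OF g] in auto)
      finally show ?thesis
        by simp
    qed
    have "norm (LINT x|lborel. g x * of_real (f x)) \<le> 0"
    proof (rule field_le_epsilon)
      fix e :: real assume "e > 0"
      \<comment> \<open>Dividing by \<open>N + 1\<close> instead of \<open>N\<close> also covers the
        case \<open>N = 0\<close>.\<close>
      define N where "N = (LINT x|lborel. norm (g x))"
      have "N \<ge> 0" by (simp add: N_def)
      then have "e / (N + 1) > 0" "e / (N + 1) * N \<le> e"
        using \<open>e > 0\<close> by (auto simp: field_simps)
      then show "norm (LINT x|lborel. g x * of_real (f x)) \<le> 0 + e"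
        using *[of "e / (N + 1)"] by (simp add: N_def)
    qed
    then show ?thesis
      by simp
  qed
  \<comment> \<open>The set where \<open>f\<close> is nonzero is open and null, hence empty.\<close>
  have sq: "(LINT x|lborel. (f x)^2) = 0 \<Longrightarrow> f x0 = 0" if f: "continuous_on UNIV f" "\<And>x. x \<notin> S \<Longrightarrow> f x = 0"
    for f :: "real^'d \<Rightarrow> real"
  proof -
    assume 0: "(LINT x|lborel. (f x)^2) = 0"
    have "integrable lborel (\<lambda>x. complex_of_real ((f x)^2))"
    proof (rule integrable_continuous_compact_support[of _ S])
      show "continuous_on UNIV (\<lambda>x. complex_of_real ((f x)^2))"
        by (intro continuous_intros f(1))
    qed (use f(2) assms(2) in auto)
    then have "integrable lborel (\<lambda>x. (f x)^2)"
      by (simp only: complex_of_real_integrable_eq)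
    then have "AE x in lborel. (f x)^2 = 0"
      using 0 by (subst integral_nonneg_eq_0_iff_AE[symmetric]) auto
    then have "{x. f x \<noteq> 0} \<in> null_sets lborel"
      using f(1) by (subst AE_iff_null_sets) (auto intro!: borel_open open_Collect_neq)
    then have "negligible {x. f x \<noteq> 0}"
      by (simp add: negligible_iff_null_sets null_sets_completionI)
    moreover have "open {x. f x \<noteq> 0}"
      by (rule open_Collect_neq[OF f(1) continuous_on_const])
    ultimately show "f x0 = 0"
      using open_not_negligible[of "{x. f x \<noteq> 0}"] by auto
  qed
  \<comment> \<open>When \<open>g\<close> is tested against its own real part, the real part of the
    vanishing integral is the integral of \<open>(Re (g x))^2\<close>; likewise below with the
    imaginary part.\<close>
  have "(LINT x|lborel. (Re (g x))^2) = 0"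
  proof -
    have c: "continuous_on UNIV (\<lambda>x. Re (g x))"
      by (intro continuous_intros assms(1))
    show ?thesis
      using integral_Re[OF int[OF c]] zero[OF c] by (simp add: power2_eq_square)
  qed
  moreover have "(LINT x|lborel. (Im (g x))^2) = 0"
  proof -
    have c: "continuous_on UNIV (\<lambda>x. Im (g x))"
      by (intro continuous_intros assms(1))
    show ?thesis
      using integral_Im[OF int[OF c]] zero[OF c] by (simp add: power2_eq_square)
  qed
  ultimately have "Re (g x0) = 0" "Im (g x0) = 0"
    using sq[of "\<lambda>x. Re (g x)"] sq[of "\<lambda>x. Im (g x)"] assms(1,3)
    by (auto intro!: continuous_intros)
  then show ?thesis
    by (simp add: complex_eq_iff)
qed

section \<open>The spectral density\<close>

lemma (in pair_sigma_finite) integrable_mult_product: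
  fixes f :: "'a \<Rightarrow> 'c::{real_normed_field,banach,second_countable_topology}"
  assumes f: "integrable M1 f" and g: "integrable M2 g"
  shows "integrable (M1 \<Otimes>\<^sub>M M2) (\<lambda>p. f (fst p) * g (snd p))"
proof (rule Fubini_integrable)
  have [measurable]: "f \<in> borel_measurable M1" "g \<in> borel_measurable M2"
    using f g by auto
  show "(\<lambda>p. f (fst p) * g (snd p)) \<in> borel_measurable (M1 \<Otimes>\<^sub>M M2)"
    by measurable
  show "integrable M1 (\<lambda>x. \<integral>y. norm (f (fst (x, y)) * g (snd (x, y))) \<partial>M2)"
    using f by (simp add: norm_mult)
  show "AE x in M1. integrable M2 (\<lambda>y. f (fst (x, y)) * g (snd (x, y)))"
    using g by simp
qed

text \<open>The integrand has modulus at most 1 on an interval of length \<open>t\<close>.\<close>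

lemma norm_gamma_kernel_le:
  assumes "0 \<le> t"
  shows "norm (gamma_kernel t \<xi> r) \<le> t"
proof -
  let ?f = "\<lambda>s. indicator {0..t} s *\<^sub>R (complex_of_real (exp (- s * r\<^sup>2)) * cis (- \<xi> * s))"
  have [measurable]: "cis \<in> borel_measurable borel"
    by (intro borel_measurable_continuous_onI continuous_intros)
  have bound: "norm (?f s) \<le> indicator {0..t} s" for s
    by (auto simp: indicator_def norm_mult)
  have ind: "integrable lborel (indicator {0..t} :: real \<Rightarrow> real)"
    by (rule integrable_real_indicator) (use assms in auto)
  have int: "integrable lborel ?f"
    by (rule Bochner_Integration.integrable_bound[OF ind]) (measurable, use bound in auto)
  have "norm (gamma_kernel t \<xi> r) = norm (LINT s|lborel. ?f s)"
    by (simp add: gamma_kernel_def norm_mult set_lebesgue_integral_def)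
  also have "\<dots> \<le> (LINT s|lborel. norm (?f s))"
    by (rule integral_norm_bound)
  also have "\<dots> \<le> (LINT s|lborel. indicator {0..t} s)"
    by (intro integral_mono integrable_norm[OF int] ind bound)
  also have "\<dots> = t"
    using assms by simp
  finally show ?thesis .
qed

text \<open>With \<open>z = Complex (r^2) \<xi>\<close> the time integral equals
  \<open>(1 - exp (- t * z)) / z\<close>. The reverse triangle inequality bounds the numerator from
  below, the squared modulus of the denominator is \<open>r^4 + \<xi>^2\<close>, and
  \<open>r \<noteq> 0\<close> makes \<open>z\<close> nonzero.\<close>

lemma norm_gamma_kernel_ge:
  assumes "0 \<le> t" "r \<noteq> 0"
  shows "(1 - exp (- t * r\<^sup>2))\<^sup>2 / (r ^ 4 + \<xi>\<^sup>2) \<le> (norm (gamma_kernel t \<xi> r))\<^sup>2"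
proof -
  define z where "z = Complex (r\<^sup>2) \<xi>"
  have z: "z \<noteq> 0"
    using assms(2) by (simp add: z_def complex_eq_iff)
  have nz: "(norm z)\<^sup>2 = r ^ 4 + \<xi>\<^sup>2"
    by (simp add: z_def cmod_power2)
  have eq: "complex_of_real (exp (- s * r\<^sup>2)) * cis (- \<xi> * s) = exp (- (of_real s * z))" for s
    by (simp add: exp_eq_polar z_def mult_ac)
  have "(LINT s:{0..t}|lborel. complex_of_real (exp (- s * r\<^sup>2)) * cis (- \<xi> * s)) =
      (LINT s|lborel. indicator {0..t} s *\<^sub>R exp (- (of_real s * z)))"
    unfolding set_lebesgue_integral_def eq ..
  also have "\<dots> = - exp (- (of_real t * z)) / z - (- exp (- (of_real 0 * z)) / z)"
  proof (rule integral_FTC_Icc[OF assms(1)])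
    fix s
    have "((\<lambda>w. - exp (- (w * z)) / z) has_field_derivative exp (- (of_real s * z))) (at (of_real s))"
      using z by (auto intro!: derivative_eq_intros)
    from has_vector_derivative_real_field[OF this]
    show "((\<lambda>s. - exp (- (of_real s * z)) / z) has_vector_derivative exp (- (of_real s * z)))
        (at s within {0..t})"
      by (rule has_vector_derivative_at_within)
  qed (intro continuous_intros)
  also have "\<dots> = (1 - exp (- (of_real t * z))) / z"
    by (simp add: diff_divide_distrib)
  finally have "norm (gamma_kernel t \<xi> r) = norm (1 - exp (- (of_real t * z))) / norm z"
    by (simp add: gamma_kernel_def norm_mult norm_divide)
  moreover have "1 - exp (- t * r\<^sup>2) \<le> norm (1 - exp (- (of_real t * z)))"
    using norm_triangle_ineq2[of 1 "exp (- (of_real t * z))"] by (simp add: z_def)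
  moreover have "0 \<le> 1 - exp (- t * r\<^sup>2)"
    using assms(1) by simp
  ultimately show ?thesis
    using nz by (auto simp: power_divide intro!: divide_right_mono power_mono)
qed

text \<open>The exponent \<open>1 - 2 * h\<close> exceeds -1, so the power is integrable at the
  origin; the negative half is a reflection of the positive one. At 0 itself \<open>powr\<close> and
  the division both give 0.\<close>

lemma integrable_abs_powr:
  fixes h R :: real
  assumes "h < 1"
  shows "integrable lborel (\<lambda>x. indicator {-R..R} x * (1 / \<bar>x\<bar> powr (2 * h - 1)))"
proof -
  have [measurable]: "{-R..R} \<in> sets borel" "{0..\<bar>R\<bar>} \<in> sets borel"
    by auto
  let ?f = "\<lambda>x. indicator {0..\<bar>R\<bar>} x * x powr (1 - 2 * h)"
  have "(\<lambda>x. x powr (1 - 2 * h)) absolutely_integrable_on {0..\<bar>R\<bar>}"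
    using assms by (subst absolutely_integrable_on_iff_nonneg) (auto intro!: integrable_on_powr_from_0)
  then have f: "integrable lborel ?f"
    unfolding set_integrable_def by (subst (asm) integrable_completion) auto
  have "integrable lborel (\<lambda>x. ?f (0 + (-1) * x))"
    by (rule lborel_integrable_real_affine[OF f]) simp
  from Bochner_Integration.integrable_add[OF f this] show ?thesis
  proof (rule Bochner_Integration.integrable_bound)
    show "AE x in lborel. norm (indicator {-R..R} x * (1 / \<bar>x\<bar> powr (2 * h - 1)))
        \<le> norm (?f x + ?f (0 + (-1) * x))"
    proof (rule AE_I2)
      fix x :: real
      have *: "1 / \<bar>x\<bar> powr (2 * h - 1) = \<bar>x\<bar> powr (1 - 2 * h)"
        using powr_minus_divide[of "\<bar>x\<bar>" "2 * h - 1"] by simp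
      show "norm (indicator {-R..R} x * (1 / \<bar>x\<bar> powr (2 * h - 1))) \<le> norm (?f x + ?f (0 + (-1) * x))"
        unfolding * by (cases "x \<ge> 0") (auto simp: indicator_def)
    qed
  qed measurable
qed

definition spectral_weight :: "real \<Rightarrow> real^'d \<Rightarrow> real \<times> (real^'d) \<Rightarrow> real" where
  "spectral_weight H0 H p =
     1 / \<bar>fst p\<bar> powr (2 * H0 - 1) * (\<Prod>i\<in>UNIV. 1 / \<bar>snd p $ i\<bar> powr (2 * H $ i - 1))"

text \<open>At equal times the product of the two kernels in the covariance is a squared modulus. Up
  to \<open>c^2\<close> and the cutoff to \<open>D_set n\<close>, this is the density of the
  spectral measure of \<open>\<Psi> n t\<close>.\<close>

definition spectral_density :: "real \<Rightarrow> real^'d \<Rightarrow> real \<Rightarrow> real \<times> (real^'d) \<Rightarrow> real" where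
  "spectral_density H0 H t p =
     spectral_weight H0 H p * (norm (gamma_kernel t (fst p) (norm (snd p))))\<^sup>2"

lemma spectral_weight_nonneg: "0 \<le> spectral_weight H0 H p"
  unfolding spectral_weight_def by (intro mult_nonneg_nonneg prod_nonneg) auto

lemma spectral_density_nonneg: "0 \<le> spectral_density H0 H t p"
  by (simp add: spectral_density_def spectral_weight_nonneg)

lemma borel_measurable_spectral_density [measurable]:
  "spectral_density H0 (H :: real^'d) t \<in> borel_measurable borel"
proof -
  have [measurable]: "cis \<in> borel_measurable borel"
    by (intro borel_measurable_continuous_onI continuous_intros)
  have [measurable]: "(\<lambda>p :: real \<times> (real^'d). gamma_kernel t (fst p) (norm (snd p)))
      \<in> borel_measurable (borel \<Otimes>\<^sub>M borel)"
    unfolding gamma_kernel_def set_lebesgue_integral_def by measurable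
  show ?thesis
    unfolding spectral_density_def[abs_def] spectral_weight_def borel_prod[symmetric] by measurable
qed

lemma sets_D_set [measurable]: "D_set n \<in> sets (borel :: (real \<times> (real^'d)) measure)"
proof -
  have eq: "D_set n = {p \<in> space (borel \<Otimes>\<^sub>M borel). \<bar>fst p\<bar> \<le> 2 ^ (2 * n) \<and> norm (snd p :: real^'d) \<le> 2 ^ n}"
    by (auto simp: D_set_def space_pair_measure)
  show ?thesis
    unfolding eq borel_prod[symmetric] by measurable
qed

text \<open>The kernel is bounded by \<open>t\<close>, and \<open>D_set n\<close> lies in a box on
  which the weight is a product of integrable one-dimensional powers.\<close>

lemma spectral_density_integrable:
  fixes H :: "real^'d"
  assumes "H0 < 1" "\<And>i. H $ i < 1" "0 \<le> t"
  shows "integrable lborel (\<lambda>p. indicator (D_set n) p * spectral_density H0 H t p)"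
proof -
  let ?a = "\<lambda>x. indicator {-(2 ^ (2 * n))..2 ^ (2 * n)} x * (1 / \<bar>x\<bar> powr (2 * H0 - 1)) :: real"
  let ?b = "\<lambda>i x. indicator {-(2 ^ n)..2 ^ n} x * (1 / \<bar>x\<bar> powr (2 * H $ i - 1)) :: real"
  have "integrable lborel (\<lambda>\<eta> :: real^'d. \<Prod>i\<in>UNIV. ?b i (\<eta> $ i))"
    using assms by (intro lborel_vec_prod(1) integrable_abs_powr)
  then have "integrable (lborel \<Otimes>\<^sub>M lborel) (\<lambda>p :: real \<times> (real^'d). ?a (fst p) * (\<Prod>i\<in>UNIV. ?b i (snd p $ i)))"
    using assms by (intro lborel_pair.integrable_mult_product integrable_abs_powr)
  then have "integrable lborel (\<lambda>p :: real \<times> (real^'d). t\<^sup>2 * (?a (fst p) * (\<Prod>i\<in>UNIV. ?b i (snd p $ i))))"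
    unfolding lborel_prod by (rule integrable_mult_right)
  then show ?thesis
  proof (rule Bochner_Integration.integrable_bound)
    show "(\<lambda>p. indicator (D_set n) p * spectral_density H0 H t p) \<in> borel_measurable lborel"
      by measurable
    show "AE p in lborel. norm (indicator (D_set n) p * spectral_density H0 H t p)
        \<le> norm (t\<^sup>2 * (?a (fst p) * (\<Prod>i\<in>UNIV. ?b i (snd p $ i))))"
    proof (rule AE_I2)
      fix p :: "real \<times> (real^'d)"
      show "norm (indicator (D_set n) p * spectral_density H0 H t p)
        \<le> norm (t\<^sup>2 * (?a (fst p) * (\<Prod>i\<in>UNIV. ?b i (snd p $ i))))"
      proof (cases "p \<in> D_set n")
        case True
        then have "\<bar>fst p\<bar> \<le> 2 ^ (2 * n)" "norm (snd p) \<le> 2 ^ n"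
          by (auto simp: D_set_def)
        moreover have "\<bar>snd p $ i\<bar> \<le> 2 ^ n" for i
          using order_trans[OF component_le_norm_cart \<open>norm (snd p) \<le> 2 ^ n\<close>] .
        ultimately have "fst p \<in> {-(2 ^ (2 * n))..2 ^ (2 * n)}" "snd p $ i \<in> {-(2 ^ n)..2 ^ n}" for i
          by (simp_all add: abs_le_iff minus_le_iff)
        then have eq: "?a (fst p) * (\<Prod>i\<in>UNIV. ?b i (snd p $ i)) = spectral_weight H0 H p"
          by (simp add: spectral_weight_def)
        have "norm (indicator (D_set n) p * spectral_density H0 H t p) =
            (norm (gamma_kernel t (fst p) (norm (snd p))))\<^sup>2 * spectral_weight H0 H p"
          using True spectral_weight_nonneg[of H0 H p] by (simp add: spectral_density_def abs_mult)
        also have "\<dots> \<le> t\<^sup>2 * spectral_weight H0 H p"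
          by (intro mult_right_mono power_mono norm_gamma_kernel_le assms(3) spectral_weight_nonneg norm_ge_zero)
        finally show ?thesis
          unfolding eq using spectral_weight_nonneg[of H0 H p] by (simp add: abs_mult)
      qed simp
    qed
  qed
qed

text \<open>The exponent lies strictly between -1 and 1, so for \<open>u = y / Y\<close> in
  \<open>[1/4, 4]\<close> the power of \<open>u\<close> is at least the smaller of \<open>u\<close>
  and \<open>1 / u\<close>, hence at least 1/4 whatever \<open>h\<close> is.\<close>

lemma powr_lower_comparable:
  fixes h y Y :: real
  assumes "0 < h" "h < 1" "0 < Y" "Y / 4 \<le> y" "y \<le> 4 * Y"
  shows "Y powr (1 - 2 * h) / 4 \<le> 1 / y powr (2 * h - 1)"
proof -
  define u where "u = y / Y"
  have u: "1 / 4 \<le> u" "u \<le> 4"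
    using assms by (auto simp: u_def field_simps)
  have "1 / 4 \<le> u powr (1 - 2 * h)"
  proof (cases "u \<ge> 1")
    case True
    have "1 / 4 \<le> u powr (- 1)"
      using u by (simp add: powr_minus_divide field_simps)
    also have "\<dots> \<le> u powr (1 - 2 * h)"
      using True assms by (intro powr_mono) auto
    finally show ?thesis .
  next
    case False
    have "1 / 4 \<le> u powr 1"
      using u by simp
    also have "\<dots> \<le> u powr (1 - 2 * h)"
      using False u assms by (intro powr_mono') auto
    finally show ?thesis .
  qed
  then have "Y powr (1 - 2 * h) * (1 / 4) \<le> Y powr (1 - 2 * h) * u powr (1 - 2 * h)"
    by (rule mult_left_mono) simp
  also have "\<dots> = (Y * u) powr (1 - 2 * h)"
    using assms u by (simp add: powr_mult)
  also have "\<dots> = 1 / y powr (2 * h - 1)"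
    using assms powr_minus_divide[of y "2 * h - 1"] by (simp add: u_def)
  finally show ?thesis
    by simp
qed

text \<open>On a parabolic block the powers in the weight scale with exponents
  \<open>2 * (1 - 2 * H0)\<close> and \<open>1 - 2 * H $ i\<close>, the squared kernel with exponent
  -4. A factor 1/4 arises from each of the \<open>CARD('d) + 1\<close> powers and from the numerator
  of the kernel bound. The range of \<open>\<eta>\<close> is wide enough to hold the second
  frequency as well, which is only close to \<open>\<zeta>0 - \<eta>\<close>.\<close>

lemma spectral_density_lower:
  fixes H :: "real^'d"
  assumes H0: "0 < H0" "H0 < 1" and H: "\<And>i. 0 < H $ i" "\<And>i. H $ i < 1"
    and X: "1 \<le> X" "16 \<le> t * X\<^sup>2" and "0 < t"
    and \<xi>: "X\<^sup>2 \<le> \<xi>" "\<xi> \<le> 2 * X\<^sup>2"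
    and \<eta>: "\<And>i. X / 4 \<le> \<bar>\<eta> $ i\<bar>" "\<And>i. \<bar>\<eta> $ i\<bar> \<le> 4 * X"
  shows "(1 / 4) ^ (CARD('d) + 2) / (256 * (real CARD('d))\<^sup>2 + 4) *
      X powr (2 * (1 - 2 * H0) + (\<Sum>i\<in>UNIV. 1 - 2 * H $ i) - 4)
    \<le> spectral_density H0 H t (\<xi>, \<eta>)"
proof -
  let ?d = "real CARD('d)"
  have "0 < X" using X by simp
  define r where "r = norm \<eta>"
  have r2: "r\<^sup>2 = (\<Sum>i\<in>UNIV. (\<eta> $ i)\<^sup>2)"
    by (simp add: r_def norm_vec_def L2_set_def sum_nonneg)
  have sq: "(X / 4)\<^sup>2 \<le> (\<eta> $ i)\<^sup>2" "(\<eta> $ i)\<^sup>2 \<le> (4 * X)\<^sup>2" for i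
    using power_mono[OF \<eta>(1)[of i], of 2] power_mono[OF \<eta>(2)[of i], of 2] \<open>0 < X\<close> by auto
  have r_up: "r\<^sup>2 \<le> ?d * (4 * X)\<^sup>2"
    unfolding r2 using sum_bounded_above[of UNIV "\<lambda>i. (\<eta> $ i)\<^sup>2"] sq(2) by simp
  have "?d * (X / 4)\<^sup>2 \<le> r\<^sup>2"
    unfolding r2 using sum_bounded_below[of UNIV _ "\<lambda>i. (\<eta> $ i)\<^sup>2"] sq(1) by simp
  moreover have "(X / 4)\<^sup>2 \<le> ?d * (X / 4)\<^sup>2"
  proof -
    have "1 \<le> ?d" by (simp add: Suc_leI)
    then show ?thesis using mult_right_mono[of 1 ?d "(X/4)\<^sup>2"] by simp
  qed
  ultimately have r_lo: "(X / 4)\<^sup>2 \<le> r\<^sup>2"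
    by simp
  then have "t * (X / 4)\<^sup>2 \<le> t * r\<^sup>2"
    using \<open>0 < t\<close> by (intro mult_left_mono) auto
  \<comment> \<open>The threshold \<open>16 \<le> t * X^2\<close> serves this step: it keeps
    \<open>1 - exp (- t * r^2)\<close> at or above 1/2.\<close>
  then have "1 \<le> t * r\<^sup>2"
    using X(2) by (simp add: power_divide)
  have "r \<noteq> 0"
    using r_lo \<open>0 < X\<close> by auto
  have "2 \<le> exp (t * r\<^sup>2)"
    using exp_ge_add_one_self[of "t * r\<^sup>2"] \<open>1 \<le> t * r\<^sup>2\<close> by linarith
  then have "exp (- t * r\<^sup>2) \<le> 1 / 2"
    by (simp add: exp_minus field_simps)
  then have "(1 / 2)\<^sup>2 \<le> (1 - exp (- t * r\<^sup>2))\<^sup>2"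
    by (intro power_mono) auto
  \<comment> \<open>The 256 comes from squaring \<open>r^2 \<le> 16 * d * X^2\<close>, with
    \<open>d\<close> the dimension, and the 4 from squaring
    \<open>\<xi> \<le> 2 * X^2\<close>.\<close>
  moreover have "r ^ 4 + \<xi>\<^sup>2 \<le> (256 * ?d\<^sup>2 + 4) * X ^ 4"
  proof -
    have "(r\<^sup>2)\<^sup>2 \<le> (?d * (4 * X)\<^sup>2)\<^sup>2"
      using r_up by (intro power_mono) auto
    moreover have "\<xi>\<^sup>2 \<le> (2 * X\<^sup>2)\<^sup>2"
      using \<xi> order_trans[OF zero_le_power2 \<xi>(1)] by (intro power_mono) auto
    ultimately show ?thesis
      by (simp add: power_mult_distrib algebra_simps flip: power_mult)
  qed
  moreover have "0 < r ^ 4 + \<xi>\<^sup>2"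
    using \<open>r \<noteq> 0\<close> by (intro add_pos_nonneg) auto
  ultimately have "(1 / 2)\<^sup>2 / ((256 * ?d\<^sup>2 + 4) * X ^ 4) \<le> (1 - exp (- t * r\<^sup>2))\<^sup>2 / (r ^ 4 + \<xi>\<^sup>2)"
    by (intro frac_le) auto
  also have "\<dots> \<le> (norm (gamma_kernel t \<xi> r))\<^sup>2"
    using \<open>0 < t\<close> \<open>r \<noteq> 0\<close> by (intro norm_gamma_kernel_ge) auto
  finally have \<gamma>: "(1 / 2)\<^sup>2 / ((256 * ?d\<^sup>2 + 4) * X ^ 4) \<le> (norm (gamma_kernel t \<xi> r))\<^sup>2" .
  have "X\<^sup>2 powr (1 - 2 * H0) / 4 \<le> 1 / \<bar>\<xi>\<bar> powr (2 * H0 - 1)"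
    using \<xi> \<open>0 < X\<close> H0 zero_le_power2[of X] by (intro powr_lower_comparable) auto
  moreover have "(\<Prod>i\<in>UNIV. X powr (1 - 2 * H $ i) / 4) \<le> (\<Prod>i\<in>UNIV. 1 / \<bar>\<eta> $ i\<bar> powr (2 * H $ i - 1))"
    using H \<eta> \<open>0 < X\<close> by (intro prod_mono conjI powr_lower_comparable) auto
  ultimately have "(X\<^sup>2 powr (1 - 2 * H0) / 4) * (\<Prod>i\<in>UNIV. X powr (1 - 2 * H $ i) / 4) *
      ((1 / 2)\<^sup>2 / ((256 * ?d\<^sup>2 + 4) * X ^ 4)) \<le> spectral_density H0 H t (\<xi>, \<eta>)"
    unfolding spectral_density_def spectral_weight_def fst_conv snd_conv r_def[symmetric]
    using \<gamma> \<open>0 < X\<close>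
    by (intro mult_mono mult_nonneg_nonneg prod_nonneg ballI zero_le_divide_1_iff[THEN iffD2]) simp_all
  moreover have "(X\<^sup>2 powr (1 - 2 * H0) / 4) * (\<Prod>i\<in>UNIV. X powr (1 - 2 * H $ i) / 4) *
      ((1 / 2)\<^sup>2 / ((256 * ?d\<^sup>2 + 4) * X ^ 4)) = (1 / 4) ^ (CARD('d) + 2) / (256 * ?d\<^sup>2 + 4) *
      X powr (2 * (1 - 2 * H0) + (\<Sum>i\<in>UNIV. 1 - 2 * H $ i) - 4)"
  proof -
    have "X\<^sup>2 powr (1 - 2 * H0) = X powr (2 * (1 - 2 * H0))"
      using \<open>0 < X\<close> by (simp add: powr_powr flip: powr_numeral)
    moreover have "(\<Prod>i\<in>(UNIV :: 'd set). X powr (1 - 2 * H $ i) / 4) =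
        X powr (\<Sum>i\<in>UNIV. 1 - 2 * H $ i) * (1 / 4) ^ CARD('d)"
      using \<open>0 < X\<close> by (simp add: powr_sum prod_dividef power_divide)
    moreover have "X powr (2 * (1 - 2 * H0) + (\<Sum>i\<in>UNIV. 1 - 2 * H $ i) - 4) =
        X powr (2 * (1 - 2 * H0)) * X powr (\<Sum>i\<in>UNIV. 1 - 2 * H $ i) / X ^ 4"
      unfolding powr_diff powr_add using \<open>0 < X\<close> by simp
    moreover have "(A / 4) * (S * q) * ((1 / 2)\<^sup>2 / (C * Z)) = q * (1 / 4)\<^sup>2 / C * (A * S / Z)"
      for A S q C Z :: real
      by (simp add: power2_eq_square mult_ac)
    ultimately show ?thesis
      by (simp only: power_add)
  qed
  ultimately show ?thesis
    by simp
qed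

text \<open>The first point is restricted to disjoint dyadic blocks \<open>P k\<close>, the second
  to a fibre on which the sum of the spatial frequencies stays in the ball. Multiplying the lower
  bounds by the volumes gives the same positive constant for every block, and these constants sum to
  infinity.\<close>

lemma spectral_convolution_diverges:
  fixes H \<zeta>0 :: "real^'d" and F :: "real^'d \<Rightarrow> real"
  assumes H0: "0 < H0" "H0 < 1" and H: "\<And>i. 0 < H $ i" "\<And>i. H $ i < 1"
    and sum: "2 * H0 + (\<Sum>i\<in>UNIV. H $ i) \<le> 3 / 4 * real CARD('d)"
    and "0 < t" "0 < \<delta>" "0 < \<epsilon>"
    and F [measurable]: "F \<in> borel_measurable borel" and F_lower: "\<And>\<zeta>. \<zeta> \<in> ball \<zeta>0 \<epsilon> \<Longrightarrow> \<delta> \<le> F \<zeta>"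
  shows "(\<integral>\<^sup>+p. (\<integral>\<^sup>+q. ennreal (spectral_density H0 H t p * spectral_density H0 H t q * F (snd p + snd q))
    \<partial>lborel) \<partial>lborel) = \<infinity>"
    (is "(\<integral>\<^sup>+p. ?\<Phi> p \<partial>lborel) = \<infinity>")
proof -
  define e where "e = 2 * (1 - 2 * H0) + (\<Sum>i\<in>UNIV. 1 - 2 * H $ i) - 4"
  define c where "c = (1 / 4) ^ (CARD('d) + 2) / (256 * (real CARD('d))\<^sup>2 + 4)"
  define V where "V = unit_ball_vol (real CARD('d)) * \<epsilon> ^ CARD('d)"
  have "0 < c"
    by (simp add: c_def add_nonneg_pos)
  have "0 < V"
    using \<open>0 < \<epsilon>\<close> by (simp add: V_def)
  define L where "L = norm \<zeta>0 + \<epsilon>"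
  \<comment> \<open>Three thresholds: 1 for the block estimates, \<open>16 / t\<close> for the
    exponential in the kernel, and \<open>2 * L\<close> to keep the sum of the two spatial
    frequencies below half of \<open>X k\<close>.\<close>
  obtain k0 where k0: "max (max 1 (16 / t)) (2 * L) < 2 ^ k0"
    using real_arch_pow[of 2 "max (max 1 (16 / t)) (2 * L)"] by auto
  define X where "X k = (2::real) ^ (k0 + k)" for k :: nat
  have X: "1 \<le> X k" "16 / t \<le> X k" "2 * L \<le> X k" for k
  proof -
    have "2 ^ k0 \<le> X k"
      unfolding X_def by (intro power_increasing) auto
    then show "1 \<le> X k" "16 / t \<le> X k" "2 * L \<le> X k"
      using k0 by auto
  qed
  have X_t: "16 \<le> t * (X k)\<^sup>2" for k
  proof -
    have "16 \<le> t * X k"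
      using X(2)[of k] \<open>0 < t\<close> by (simp add: field_simps)
    also have "\<dots> \<le> t * (X k)\<^sup>2"
      using X(1)[of k] \<open>0 < t\<close> by (intro mult_left_mono) (auto simp: power2_eq_square)
    finally show ?thesis .
  qed
  define I where "I k = {(X k)\<^sup>2..2 * (X k)\<^sup>2}" for k
  define P where "P k = I k \<times> box (\<chi> i. X k) (\<chi> i. 2 * X k :: real^'d)" for k
  have em_I: "emeasure lborel (I k) = ennreal ((X k)\<^sup>2)" for k
    by (simp add: I_def)
  have em_prod: "emeasure lborel (A \<times> B) = emeasure lborel A * emeasure lborel B"
    if "A \<in> sets borel" "B \<in> sets borel" for A :: "real set" and B :: "(real^'d) set"
    using lborel.emeasure_pair_measure_Times[of A lborel B] that by (simp add: lborel_prod)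
  have P_sets [measurable]: "P k \<in> sets borel" for k
    unfolding P_def I_def borel_prod[symmetric] by (intro pair_measureI) auto
  have em_P: "emeasure lborel (P k) = ennreal ((X k)\<^sup>2 * X k ^ CARD('d))" for k
  proof -
    have "emeasure lborel (box (\<chi> i. X k) (\<chi> i. 2 * X k :: real^'d)) = ennreal (X k ^ CARD('d))"
    proof -
      have b: "((\<chi> i. 2 * X k) - (\<chi> i. X k) :: real^'d) \<bullet> b = X k"
        and "(\<chi> i. X k) \<bullet> b \<le> (\<chi> i. 2 * X k :: real^'d) \<bullet> b" if "b \<in> Basis" for b :: "real^'d"
        using that X(1)[of k] by (auto simp: Basis_vec_def inner_axis)
      then show ?thesis
        by (subst emeasure_lborel_box) (auto simp: b cong: prod.cong simp del: inner_diff_left)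
    qed
    then show ?thesis
      using X(1)[of k] unfolding P_def by (subst em_prod) (auto simp: em_I I_def ennreal_mult)
  qed
  \<comment> \<open>For \<open>j < k\<close> one has \<open>2 * X j \<le> X k\<close>, and the boxes
    are open, so no coordinate can lie in both ranges.\<close>
  have disj: "disjoint_family P"
  proof -
    have "P j \<inter> P k = {}" if "j < k" for j k
    proof -
      have "2 * X j \<le> X k"
        using that unfolding X_def power_Suc[symmetric] by (intro power_increasing) auto
      then show ?thesis
        by (auto simp: P_def mem_box_cart) (meson less_le_trans less_trans not_less_iff_gr_or_eq)
    qed
    then show ?thesis
      unfolding disjoint_family_on_def by (metis Int_commute linorder_neqE_nat)
  qed
  have inner: "ennreal (c\<^sup>2 * \<delta> * X k powr (2 * e) * ((X k)\<^sup>2 * V)) \<le> ?\<Phi> p" if p: "p \<in> P k" for p k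
  proof -
    \<comment> \<open>The second point has the same range of time frequencies; its spatial frequency
      runs over the ball that puts the sum within \<open>\<epsilon>\<close> of
      \<open>\<zeta>0\<close>.\<close>
    let ?Q = "I k \<times> ball (\<zeta>0 - snd p) \<epsilon>"
    have p': "(X k)\<^sup>2 \<le> fst p" "fst p \<le> 2 * (X k)\<^sup>2" "\<And>i. X k < snd p $ i" "\<And>i. snd p $ i < 2 * X k"
      using p by (auto simp: P_def I_def mem_box_cart)
    have dens_p: "c * X k powr e \<le> spectral_density H0 H t p"
    proof -
      have "X k / 4 \<le> \<bar>snd p $ i\<bar>" "\<bar>snd p $ i\<bar> \<le> 4 * X k" for i
        using p'(3,4)[of i] X(1)[of k] by auto
      from spectral_density_lower[OF H0 H X(1) X_t \<open>0 < t\<close> p'(1,2) this] show ?thesis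
        by (simp add: c_def e_def)
    qed
    have dens_q: "c * X k powr e \<le> spectral_density H0 H t q" and F_q: "\<delta> \<le> F (snd p + snd q)"
      if q: "q \<in> ?Q" for q
    proof -
      have q': "(X k)\<^sup>2 \<le> fst q" "fst q \<le> 2 * (X k)\<^sup>2" "dist (\<zeta>0 - snd p) (snd q) < \<epsilon>"
        using q by (auto simp: I_def)
      have d: "dist (\<zeta>0 - snd p) (snd q) = norm (\<zeta>0 - (snd p + snd q))"
        by (simp add: dist_norm algebra_simps)
      then show "\<delta> \<le> F (snd p + snd q)"
        using q'(3) by (intro F_lower) (simp add: dist_norm)
      have "norm (snd p + snd q) \<le> norm \<zeta>0 + norm (\<zeta>0 - (snd p + snd q))"
        using norm_triangle_ineq4[of \<zeta>0 "\<zeta>0 - (snd p + snd q)"] by simp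
      then have "norm (snd p + snd q) \<le> L"
        using q'(3) d by (simp add: L_def)
      then have *: "\<bar>snd p $ i + snd q $ i\<bar> \<le> X k / 2" for i
        using component_le_norm_cart[of "snd p + snd q" i] X(3)[of k] by simp
      \<comment> \<open>The first coordinate lies between \<open>X k\<close> and
        \<open>2 * X k\<close> and the sum is at most \<open>X k / 2\<close> in modulus, so the
        second coordinate has modulus between \<open>X k / 2\<close> and
        \<open>5 / 2 * X k\<close>.\<close>
      have "X k / 4 \<le> \<bar>snd q $ i\<bar>" "\<bar>snd q $ i\<bar> \<le> 4 * X k" for i
        using *[of i] p'(3,4)[of i] X(1)[of k] by linarith+
      from spectral_density_lower[OF H0 H X(1) X_t \<open>0 < t\<close> q'(1,2) this]
      show "c * X k powr e \<le> spectral_density H0 H t q"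
        by (simp add: c_def e_def)
    qed
    have "ennreal (c\<^sup>2 * \<delta> * X k powr (2 * e) * ((X k)\<^sup>2 * V)) =
        ennreal (c\<^sup>2 * \<delta> * X k powr (2 * e)) * emeasure lborel ?Q"
    proof -
      have "emeasure lborel ?Q = ennreal ((X k)\<^sup>2 * V)"
        using \<open>0 < \<epsilon>\<close> \<open>0 < V\<close>
        by (subst em_prod) (auto simp: em_I I_def emeasure_ball V_def ennreal_mult less_imp_le)
      then show ?thesis
        using \<open>0 < V\<close> \<open>0 < \<delta>\<close> by (simp add: ennreal_mult)
    qed
    also have "\<dots> = (\<integral>\<^sup>+q. ennreal (c\<^sup>2 * \<delta> * X k powr (2 * e)) * indicator ?Q q \<partial>lborel)"
      by (subst nn_integral_cmult_indicator) (auto simp: I_def borel_prod[symmetric] intro!: pair_measureI)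
    also have "\<dots> \<le> ?\<Phi> p"
    proof (rule nn_integral_mono)
      fix q :: "real \<times> (real^'d)"
      show "ennreal (c\<^sup>2 * \<delta> * X k powr (2 * e)) * indicator ?Q q \<le>
        ennreal (spectral_density H0 H t p * spectral_density H0 H t q * F (snd p + snd q))"
      proof (cases "q \<in> ?Q")
        case True
        have "c\<^sup>2 * \<delta> * X k powr (2 * e) = (c * X k powr e) * (c * X k powr e) * \<delta>"
          using powr_add[of "X k" e e] by (simp add: power2_eq_square)
        also have "\<dots> \<le> spectral_density H0 H t p * spectral_density H0 H t q * F (snd p + snd q)"
          using \<open>0 < c\<close> \<open>0 < \<delta>\<close>
          by (intro mult_mono dens_p dens_q[OF True] F_q[OF True] mult_nonneg_nonneg spectral_density_nonneg) auto
        finally show ?thesis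
          using True by (simp add: ennreal_leI)
      qed simp
    qed
    finally show ?thesis .
  qed
  have block: "ennreal (c\<^sup>2 * \<delta> * V) \<le> (\<integral>\<^sup>+p\<in>P k. ?\<Phi> p \<partial>lborel)" for k
  proof -
    have "(\<Sum>i\<in>(UNIV :: 'd set). 1 - 2 * H $ i) = real CARD('d) - 2 * (\<Sum>i\<in>UNIV. H $ i)"
      by (simp add: sum_subtractf sum_distrib_left)
    \<comment> \<open>The two densities contribute the exponent \<open>2 * e\<close>, the block
      \<open>P k\<close> contributes 2 plus the dimension \<open>d\<close>, and the fibre
      contributes 2. The total is \<open>3 * d - 8 * H0 - 4 * (\<Sum>i\<in>UNIV. H $ i)\<close>,
      four times the slack in the hypothesis on the Hurst parameters, so the contributions of the
      blocks do not decay.\<close>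
    then have "0 \<le> 2 * e + 4 + real CARD('d)"
      using sum by (simp add: e_def)
    then have "1 \<le> X k powr (2 * e + 4 + real CARD('d))"
      using X(1)[of k] by (simp add: ge_one_powr_ge_zero)
    also have "\<dots> = X k powr (2 * e) * (X k)\<^sup>2 * ((X k)\<^sup>2 * X k ^ CARD('d))"
      using X(1)[of k] by (simp add: powr_add powr_realpow power2_eq_square power4_eq_xxxx)
    finally have "c\<^sup>2 * \<delta> * V * 1 \<le> c\<^sup>2 * \<delta> * V * (X k powr (2 * e) * (X k)\<^sup>2 * ((X k)\<^sup>2 * X k ^ CARD('d)))"
      using \<open>0 < c\<close> \<open>0 < \<delta>\<close> \<open>0 < V\<close> by (intro mult_left_mono) auto
    then have "ennreal (c\<^sup>2 * \<delta> * V) \<le>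
        ennreal ((c\<^sup>2 * \<delta> * X k powr (2 * e) * ((X k)\<^sup>2 * V)) * ((X k)\<^sup>2 * X k ^ CARD('d)))"
      by (intro ennreal_leI) (simp add: mult_ac)
    also have "\<dots> = ennreal (c\<^sup>2 * \<delta> * X k powr (2 * e) * ((X k)\<^sup>2 * V)) * emeasure lborel (P k)"
      unfolding em_P using X(1)[of k] \<open>0 < c\<close> \<open>0 < \<delta>\<close> \<open>0 < V\<close> by (intro ennreal_mult) auto
    also have "\<dots> = (\<integral>\<^sup>+p. ennreal (c\<^sup>2 * \<delta> * X k powr (2 * e) * ((X k)\<^sup>2 * V)) * indicator (P k) p \<partial>lborel)"
      by (subst nn_integral_cmult_indicator) auto
    also have "\<dots> \<le> (\<integral>\<^sup>+p\<in>P k. ?\<Phi> p \<partial>lborel)"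
      using inner by (intro nn_integral_mono) (auto simp: indicator_def)
    finally show ?thesis .
  qed
  have \<Phi> [measurable]: "?\<Phi> \<in> borel_measurable lborel"
  proof -
    have [measurable]: "(\<lambda>(p, q). ennreal (spectral_density H0 H t p * spectral_density H0 H t q *
        F (snd p + snd q))) \<in> borel_measurable (borel \<Otimes>\<^sub>M borel)"
    proof -
      have [measurable]: "snd \<in> borel_measurable (borel :: (real \<times> (real^'d)) measure)"
        unfolding borel_prod[symmetric] by measurable
      show ?thesis
        by measurable
    qed
    show ?thesis
      by measurable
  qed
  have "c\<^sup>2 * \<delta> * V \<noteq> 0" "0 \<le> c\<^sup>2 * \<delta> * V"
    using \<open>0 < c\<close> \<open>0 < \<delta>\<close> \<open>0 < V\<close> by simp_all
  then have "\<not> summable (\<lambda>k::nat. c\<^sup>2 * \<delta> * V)"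
    by (simp only: summable_const_iff not_False_eq_True)
  then have "\<infinity> = (\<Sum>k::nat. ennreal (c\<^sup>2 * \<delta> * V))"
    using summable_suminf_not_top[of "\<lambda>_::nat. c\<^sup>2 * \<delta> * V"] \<open>0 \<le> c\<^sup>2 * \<delta> * V\<close>
    unfolding infinity_ennreal_def by metis
  also have "\<dots> \<le> (\<Sum>k. \<integral>\<^sup>+p\<in>P k. ?\<Phi> p \<partial>lborel)"
    by (intro suminf_le block) auto
  also have "\<dots> = (\<integral>\<^sup>+p\<in>(\<Union>k. P k). ?\<Phi> p \<partial>lborel)"
    by (rule nn_integral_disjoint_family[symmetric]) (use disj in auto)
  also have "\<dots> \<le> (\<integral>\<^sup>+p. ?\<Phi> p \<partial>lborel)"
    by (intro nn_integral_mono) (auto simp: indicator_def)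
  finally show ?thesis
    by (simp add: top_unique)
qed

section \<open>Duality with a Gaussian\<close>

text \<open>Otherwise \<open>f\<close> would vanish almost everywhere, and the whole space would be
  a null set.\<close>

lemma integral_lborel_pos:
  fixes f :: "'a::euclidean_space \<Rightarrow> real"
  assumes "integrable lborel f" "\<And>x. 0 < f x"
  shows "0 < (LINT x|lborel. f x)"
proof (rule ccontr)
  assume "\<not> ?thesis"
  moreover have "0 \<le> (LINT x|lborel. f x)"
    using assms(2) by (intro integral_nonneg_AE) (auto intro: less_imp_le)
  ultimately have "(LINT x|lborel. f x) = 0"
    by simp
  then have "AE x in lborel. f x = 0"
    using assms by (subst (asm) integral_nonneg_eq_0_iff_AE) (auto intro: less_imp_le)
  then have "AE x in (lborel :: 'a measure). False"
    using assms(2) by (auto elim!: eventually_mono simp: less_le)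
  then have "emeasure lborel (UNIV :: 'a set) = 0"
    by (subst (asm) AE_iff_measurable[OF _ refl]) auto
  then show False
    by simp
qed

text \<open>The Cauchy-Schwarz inequality. For a non-integrable product the Bochner integral is 0 by
  convention and the bound is immediate.\<close>

lemma norm_integral_mult_le_L2_norm:
  fixes g h :: "real^'d \<Rightarrow> complex"
  assumes "square_integrable g" "square_integrable h"
  shows "norm (LINT x|lborel. g x * h x) \<le> L2_norm g * L2_norm h"
proof (cases "integrable lborel (\<lambda>x. g x * h x)")
  case True
  have [measurable]: "g \<in> borel_measurable borel" "h \<in> borel_measurable borel"
    and int: "integrable lborel (\<lambda>x. (norm (g x))\<^sup>2)" "integrable lborel (\<lambda>x. (norm (h x))\<^sup>2)"
    using assms by (auto simp: square_integrable_def)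
  let ?I = "norm (LINT x|lborel. g x * h x)"
  have "ennreal ?I \<le> (\<integral>\<^sup>+x. ennreal (norm (g x)) * ennreal (norm (h x)) \<partial>lborel)"
    using integral_norm_bound_ennreal[OF True] by (simp add: norm_mult ennreal_mult)
  then have "(ennreal ?I)\<^sup>2 \<le> (\<integral>\<^sup>+x. ennreal (norm (g x)) * ennreal (norm (h x)) \<partial>lborel)\<^sup>2"
    by (rule power_mono) simp
  also have "\<dots> \<le> (\<integral>\<^sup>+x. (ennreal (norm (g x)))\<^sup>2 \<partial>lborel) * (\<integral>\<^sup>+x. (ennreal (norm (h x)))\<^sup>2 \<partial>lborel)"
    by (rule Cauchy_Schwarz_nn_integral) auto
  also have "\<dots> = ennreal (LINT x|lborel. (norm (g x))\<^sup>2) * ennreal (LINT x|lborel. (norm (h x))\<^sup>2)"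
    using int by (simp add: ennreal_power nn_integral_eq_integral)
  finally have "?I\<^sup>2 \<le> (LINT x|lborel. (norm (g x))\<^sup>2) * (LINT x|lborel. (norm (h x))\<^sup>2)"
    by (simp add: ennreal_power ennreal_mult[symmetric])
  then have "sqrt (?I\<^sup>2) \<le> L2_norm g * L2_norm h"
    unfolding L2_norm_def real_sqrt_mult[symmetric] by (rule real_sqrt_le_mono)
  then show ?thesis
    by simp
qed (simp add: not_integrable_integral_eq L2_norm_def)

text \<open>Cauchy-Schwarz is applied to every representing function. If there is none, the infimum
  is infinite; a vanishing norm of \<open>\<phi>\<close> is covered by the convention
  \<open>x / 0 = 0\<close>.\<close>

lemma L2_norm_distribution_ge:
  assumes "schwartz_function \<phi>" "square_integrable \<phi>"
  shows "ennreal (norm (u \<phi>) / L2_norm \<phi>) \<le> L2_norm_distribution u"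
  unfolding L2_norm_distribution_def
proof (rule INF_greatest, clarsimp)
  fix g assume g: "square_integrable g" "\<forall>\<phi>. schwartz_function \<phi> \<longrightarrow> u \<phi> = distribution_of g \<phi>"
  have "norm (u \<phi>) \<le> L2_norm g * L2_norm \<phi>"
    using norm_integral_mult_le_L2_norm[OF g(1) assms(2)] g(2) assms(1) by (simp add: distribution_of_def)
  moreover have "0 \<le> L2_norm g" "0 \<le> L2_norm \<phi>"
    by (auto simp: L2_norm_def)
  ultimately show "ennreal (norm (u \<phi>) / L2_norm \<phi>) \<le> ennreal (L2_norm g)"
    by (intro ennreal_leI) (simp add: divide_simps)
qed

lemma gaussian_at_square_integrable: "square_integrable (gaussian_at x0)" for x0 :: "real^'d"
proof -
  have "gaussian_at x0 \<in> borel_measurable lborel"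
    unfolding gaussian_at_def[abs_def] by measurable
  then show ?thesis
    using square_integrable_gaussian_at by (simp add: square_integrable_def)
qed

lemma L2_norm_gaussian_at_pos: "0 < L2_norm (gaussian_at x0)" for x0 :: "real^'d"
  unfolding L2_norm_def using integral_lborel_pos[OF square_integrable_gaussian_at[of x0]]
  by (simp add: gaussian_at_def)

text \<open>Unfolding the dualities moves the Bessel multiplier onto the Gaussian, which turns into
  \<open>\<psi>\<close>. At \<open>x0\<close> the phases cancel, so \<open>\<psi> x0\<close> is the
  integral of a strictly positive function. The sign of \<open>s\<close> gives
  \<open>m \<xi> \<le> 1\<close>, so that a Gaussian dominates the integrand.\<close>

lemma bessel_potential_gaussian_at:
  fixes x0 :: "real^'d"
  assumes "s \<le> 0"
  obtains \<psi> where "continuous_on UNIV \<psi>" "\<psi> x0 \<noteq> 0"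
    "\<And>f. bessel_potential s (distribution_of f) (gaussian_at x0) = (LINT x|lborel. f x * \<psi> x)"
proof -
  define m where "m \<xi> = (1 + (norm \<xi>)\<^sup>2) powr (s / 2)" for \<xi> :: "real^'d"
  define K where "K = 1 / (2 * pi) ^ CARD('d) * sqrt (2 * pi) ^ CARD('d)"
  define \<kappa> where "\<kappa> \<xi> = m \<xi> * (K * exp (- (norm \<xi>)\<^sup>2 / 2))" for \<xi> :: "real^'d"
  define \<psi> where "\<psi> = fourier (\<lambda>\<xi>. complex_of_real (m \<xi>) * inverse_fourier (gaussian_at x0) \<xi>)"
  have K: "K > 0"
    by (simp add: K_def)
  have m: "0 < m \<xi>" "m \<xi> \<le> 1" for \<xi>
  proof -
    have "0 < 1 + (norm \<xi>)\<^sup>2"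
      by (simp add: add_pos_nonneg)
    then show "0 < m \<xi>"
      by (simp add: m_def)
    show "m \<xi> \<le> 1"
      using powr_mono[of "s / 2" 0 "1 + (norm \<xi>)\<^sup>2"] assms \<open>0 < 1 + _\<close> by (simp add: m_def)
  qed
  have \<kappa>_int: "integrable lborel \<kappa>"
  proof (rule Bochner_Integration.integrable_bound[OF integrable_mult_right[OF integrable_gaussian, of K]])
    show "\<kappa> \<in> borel_measurable lborel"
      unfolding \<kappa>_def m_def by measurable
    show "AE \<xi> in lborel. norm (\<kappa> \<xi>) \<le> norm (K * exp (- (norm \<xi>)\<^sup>2 / 2))"
      using m K by (intro AE_I2) (simp add: \<kappa>_def abs_mult mult_left_le_one_le less_imp_le)
  qed
  have \<psi>_eq: "\<psi> x = (LINT \<xi>|lborel. complex_of_real (\<kappa> \<xi>) * cis ((x0 - x) \<bullet> \<xi>))" for x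
    unfolding \<psi>_def fourier_def
  proof (rule Bochner_Integration.integral_cong[OF refl])
    fix \<xi> :: "real^'d"
    have "cis ((x0 - x) \<bullet> \<xi>) = cis (- (\<xi> \<bullet> x)) * cis (x0 \<bullet> \<xi>)"
      by (simp add: cis_mult inner_diff_left inner_commute[of \<xi>])
    then show "cis (- (\<xi> \<bullet> x)) * (complex_of_real (m \<xi>) * inverse_fourier (gaussian_at x0) \<xi>) =
        complex_of_real (\<kappa> \<xi>) * cis ((x0 - x) \<bullet> \<xi>)"
      by (simp add: inverse_fourier_gaussian_at \<kappa>_def K_def)
  qed
  show ?thesis
  proof
    have "continuous_on UNIV ((\<lambda>\<theta>. LINT \<xi>|lborel. complex_of_real (\<kappa> \<xi>) * cis (\<theta> \<bullet> \<xi>)) \<circ> (\<lambda>x. x0 - x))"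
      using \<kappa>_int by (intro continuous_on_compose continuous_intros
          continuous_on_subset[OF continuous_integral_cis subset_UNIV]) simp
    then show "continuous_on UNIV \<psi>"
      by (simp add: \<psi>_eq[abs_def] comp_def)
    have "\<psi> x0 = complex_of_real (LINT \<xi>|lborel. \<kappa> \<xi>)"
      by (simp add: \<psi>_eq)
    moreover have "0 < (LINT \<xi>|lborel. \<kappa> \<xi>)"
      using m K by (intro integral_lborel_pos \<kappa>_int) (simp add: \<kappa>_def)
    ultimately show "\<psi> x0 \<noteq> 0"
      by simp
    show "bessel_potential s (distribution_of f) (gaussian_at x0) = (LINT x|lborel. f x * \<psi> x)" for f
      by (simp add: bessel_potential_def inverse_fourier_distribution_def mult_distribution_def
          fourier_distribution_def distribution_of_def \<psi>_def m_def)
  qed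
qed

section \<open>Second moments as spectral integrals\<close>

lemma (in pair_sigma_finite) integral_mult_product:
  fixes f :: "'a \<Rightarrow> 'c::{real_normed_field,banach,second_countable_topology}"
  assumes "integrable M1 f" "integrable M2 g"
  shows "(LINT p|(M1 \<Otimes>\<^sub>M M2). f (fst p) * g (snd p)) = (LINT x|M1. f x) * (LINT y|M2. g y)"
  using integral_fst'[OF integrable_mult_product[OF assms]] by simp

text \<open>Joint measurability of a Caratheodory function: simple functions converging to the
  identity in \<open>x\<close> give approximations made of finitely many measurable pieces, and
  continuity in \<open>x\<close> passes to the limit.\<close>

lemma borel_measurable_caratheodory:
  fixes W :: "'x::{second_countable_topology, metric_space} \<Rightarrow> 'w \<Rightarrow> 'b::metric_space"
  assumes meas: "\<And>x. W x \<in> borel_measurable M"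
    and cont: "\<And>\<omega>. \<omega> \<in> space M \<Longrightarrow> continuous_on UNIV (\<lambda>x. W x \<omega>)"
  shows "(\<lambda>p. W (fst p) (snd p)) \<in> borel_measurable (borel \<Otimes>\<^sub>M M)"
proof -
  obtain F where F: "\<And>i. simple_function (borel :: 'x measure) (F i)"
    and lim: "\<And>x. (\<lambda>i. F i x) \<longlonglongrightarrow> x"
    using borel_measurable_implies_sequence_metric[of "\<lambda>x. x" "borel :: 'x measure" undefined] by auto
  show ?thesis
  proof (rule borel_measurable_LIMSEQ_metric)
    show "(\<lambda>p. W (F i (fst p)) (snd p)) \<in> borel_measurable (borel \<Otimes>\<^sub>M M)" for i
    proof (rule measurable_compose_countable'[where I = "range (F i)"])
      show "(\<lambda>p. W x (snd p)) \<in> borel_measurable (borel \<Otimes>\<^sub>M M)" for x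
        using meas[of x] by measurable
      have "F i \<in> borel \<rightarrow>\<^sub>M count_space (range (F i))"
        using F[of i] by (subst measurable_count_space_eq2) (auto simp: simple_function_def)
      then show "(\<lambda>p. F i (fst p)) \<in> borel \<Otimes>\<^sub>M M \<rightarrow>\<^sub>M count_space (range (F i))"
        by (rule measurable_compose[OF measurable_fst])
      show "countable (range (F i))"
        using F[of i] by (auto simp: simple_function_def intro: countable_finite)
    qed
    fix p assume "p \<in> space ((borel :: 'x measure) \<Otimes>\<^sub>M M)"
    then have "snd p \<in> space M"
      by (auto simp: space_pair_measure)
    from continuous_on_tendsto_compose[OF cont[OF this] lim]
    show "(\<lambda>i. W (F i (fst p)) (snd p)) \<longlonglongrightarrow> W (fst p) (snd p)"
      by simp
  qed
qed

text \<open>The square is expanded into a double integral over frequencies; integrating over the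
  space variables first then produces the squared modulus of \<open>G\<close>. The square carries no
  conjugate, so the frequencies add. Fubini's theorem applies because \<open>g\<close> and
  \<open>w\<close> are integrable and the phases have modulus 1.\<close>

lemma spectral_quadratic_form:
  fixes w :: "'p::euclidean_space \<Rightarrow> real" and g :: "real^'d \<Rightarrow> complex" and \<theta> :: "'p \<Rightarrow> real^'d"
  assumes w: "integrable lborel w" and g: "integrable lborel g" and \<theta>: "\<theta> \<in> borel_measurable borel"
  defines "G \<equiv> \<lambda>\<zeta>. LINT x|lborel. g x * cis (\<zeta> \<bullet> x)"
  shows "integrable lborel (\<lambda>q. w (fst q) * w (snd q) * (norm (G (\<theta> (fst q) + \<theta> (snd q))))\<^sup>2)"
    and "(LINT z|lborel. g (fst z) * cnj (g (snd z)) *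
        (LINT p|lborel. complex_of_real (w p) * cis (\<theta> p \<bullet> (fst z - snd z)))\<^sup>2) =
      complex_of_real (LINT q|lborel. w (fst q) * w (snd q) * (norm (G (\<theta> (fst q) + \<theta> (snd q))))\<^sup>2)"
proof -
  let ?gg = "\<lambda>z. g (fst z) * cnj (g (snd z))"
  let ?ww = "\<lambda>q. complex_of_real (w (fst q)) * complex_of_real (w (snd q))"
  let ?t = "\<lambda>q. \<theta> (fst q) + \<theta> (snd q)"
  have [measurable]: "\<theta> \<in> borel_measurable borel" "w \<in> borel_measurable borel" "g \<in> borel_measurable borel"
    using assms by auto
  have w': "integrable lborel (\<lambda>p. complex_of_real (w p))"
    using w by simp
  have gg: "integrable lborel ?gg"
    using lborel_pair.integrable_mult_product[OF g, of "\<lambda>x. cnj (g x)"] g by (simp add: lborel_prod)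
  have ww: "integrable lborel ?ww"
    using lborel_pair.integrable_mult_product[OF w' w'] by (simp add: lborel_prod)
  have "integrable (lborel \<Otimes>\<^sub>M lborel) (\<lambda>u. ?gg (fst u) * ?ww (snd u) * cis (?t (snd u) \<bullet> (fst (fst u) - snd (fst u))))"
  proof (rule integrable_mult_cis[OF lborel_pair.integrable_mult_product[OF gg ww]])
    have "(\<lambda>u. ?t (snd u) \<bullet> (fst (fst u) - snd (fst u))) \<in>
        borel_measurable ((borel \<Otimes>\<^sub>M borel) \<Otimes>\<^sub>M (borel \<Otimes>\<^sub>M borel))"
      by measurable
    then show "(\<lambda>u. ?t (snd u) \<bullet> (fst (fst u) - snd (fst u))) \<in> borel_measurable (lborel \<Otimes>\<^sub>M lborel)"
      unfolding borel_prod lborel_prod measurable_lborel2 .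
  qed
  then have int: "integrable (lborel \<Otimes>\<^sub>M lborel)
      (case_prod (\<lambda>z q. ?gg z * ?ww q * cis (?t q \<bullet> (fst z - snd z))))"
    by (simp add: case_prod_beta')
  have sq: "?gg z * (LINT p|lborel. complex_of_real (w p) * cis (\<theta> p \<bullet> (fst z - snd z)))\<^sup>2 =
      (LINT q|lborel. ?gg z * ?ww q * cis (?t q \<bullet> (fst z - snd z)))" for z
  proof -
    let ?f = "\<lambda>p. complex_of_real (w p) * cis (\<theta> p \<bullet> (fst z - snd z))"
    have f: "integrable lborel ?f"
      by (rule integrable_mult_cis[OF w']) simp
    have "(LINT p|lborel. ?f p)\<^sup>2 = (LINT q|lborel. ?f (fst q) * ?f (snd q))"
      using lborel_pair.integral_mult_product[OF f f] by (simp add: lborel_prod power2_eq_square)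
    also have "?gg z * \<dots> = (LINT q|lborel. ?gg z * (?f (fst q) * ?f (snd q)))"
      by (rule integral_mult_right_zero[symmetric])
    also have "\<dots> = (LINT q|lborel. ?gg z * ?ww q * cis (?t q \<bullet> (fst z - snd z)))"
      by (rule Bochner_Integration.integral_cong[OF refl])
        (simp add: inner_add_left cis_mult[symmetric] mult_ac)
    finally show ?thesis .
  qed
  have inner: "(LINT z|lborel. ?gg z * ?ww q * cis (?t q \<bullet> (fst z - snd z))) =
      complex_of_real (w (fst q) * w (snd q) * (norm (G (?t q)))\<^sup>2)" for q
  proof -
    let ?f = "\<lambda>x. g x * cis (?t q \<bullet> x)"
    have f: "integrable lborel ?f"
      by (rule integrable_mult_cis[OF g]) simp
    then have f': "integrable lborel (\<lambda>x. cnj (?f x))"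
      by (simp only: integrable_cnj)
    have "G (?t q) * cnj (G (?t q)) = (LINT z|lborel. ?f (fst z) * cnj (?f (snd z)))"
      using lborel_pair.integral_mult_product[OF f f'] unfolding G_def
      by (simp only: lborel_prod Bochner_Integration.integral_cnj)
    then have "?ww q * (G (?t q) * cnj (G (?t q))) = (LINT z|lborel. ?ww q * (?f (fst z) * cnj (?f (snd z))))"
      by (simp only: integral_mult_right_zero)
    also have "\<dots> = (LINT z|lborel. ?gg z * ?ww q * cis (?t q \<bullet> (fst z - snd z)))"
    proof (rule Bochner_Integration.integral_cong[OF refl])
      fix z :: "(real^'d) \<times> (real^'d)"
      have "cis (?t q \<bullet> (fst z - snd z)) = cis (?t q \<bullet> fst z) * cnj (cis (?t q \<bullet> snd z))"
        by (simp add: inner_diff_right cis_cnj cis_mult)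
      then show "?ww q * (?f (fst z) * cnj (?f (snd z))) = ?gg z * ?ww q * cis (?t q \<bullet> (fst z - snd z))"
        by (simp only: complex_cnj_mult mult_ac)
    qed
    finally show ?thesis
      by (simp only: complex_norm_square of_real_mult)
  qed
  have "integrable lborel (\<lambda>q. complex_of_real (w (fst q) * w (snd q) * (norm (G (?t q)))\<^sup>2))"
    using lborel_pair.integrable_snd[OF int] unfolding inner .
  then show "integrable lborel (\<lambda>q. w (fst q) * w (snd q) * (norm (G (?t q)))\<^sup>2)"
    by (simp only: complex_of_real_integrable_eq)
  show "(LINT z|lborel. ?gg z *
        (LINT p|lborel. complex_of_real (w p) * cis (\<theta> p \<bullet> (fst z - snd z)))\<^sup>2) =
      complex_of_real (LINT q|lborel. w (fst q) * w (snd q) * (norm (G (?t q)))\<^sup>2)"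
    unfolding sq using lborel_pair.Fubini_integral[OF int] unfolding inner
    by (simp only: integral_complex_of_real)
qed

text \<open>The squared modulus is expanded into a double integral and exchanged with the
  expectation. Continuity in \<open>x\<close> gives joint measurability; the uniform second-moment
  bound together with the integrability of \<open>g\<close> justifies Fubini's theorem.\<close>

lemma (in prob_space) second_moment_of_integral:
  fixes g :: "real^'d \<Rightarrow> complex" and W :: "real^'d \<Rightarrow> 'a \<Rightarrow> real"
  assumes meas: "\<And>x. W x \<in> borel_measurable M"
    and cont: "\<And>\<omega>. \<omega> \<in> space M \<Longrightarrow> continuous_on UNIV (\<lambda>x. W x \<omega>)"
    and g: "continuous_on UNIV g" "compact S" "\<And>x. x \<notin> S \<Longrightarrow> g x = 0"
    and int: "\<And>x. integrable M (\<lambda>\<omega>. (W x \<omega>)\<^sup>2)"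
    and bound: "\<And>x. expectation (\<lambda>\<omega>. (W x \<omega>)\<^sup>2) \<le> B"
  shows "(\<lambda>\<omega>. LINT x|lborel. g x * of_real (W x \<omega>)) \<in> borel_measurable M"
    and "(\<integral>\<^sup>+\<omega>. ennreal ((norm (LINT x|lborel. g x * of_real (W x \<omega>)))\<^sup>2) \<partial>M) =
      ennreal (Re (LINT z|lborel. g (fst z) * cnj (g (snd z)) *
        complex_of_real (expectation (\<lambda>\<omega>. W (fst z) \<omega> * W (snd z) \<omega>))))"
proof -
  interpret pair_sigma_finite M "lborel :: ((real^'d) \<times> (real^'d)) measure" ..
  let ?gg = "\<lambda>z. g (fst z) * cnj (g (snd z))"
  note W [measurable] = borel_measurable_caratheodory[of W M, OF meas cont]
  have g_int: "integrable lborel g"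
    by (rule integrable_continuous_compact_support[OF g])
  then have [measurable]: "g \<in> borel_measurable borel"
    by auto
  have [measurable]: "cnj \<in> borel_measurable borel"
    by (intro borel_measurable_continuous_onI continuous_intros)
  have gW: "integrable lborel (\<lambda>x. g x * of_real (W x \<omega>))" if "\<omega> \<in> space M" for \<omega>
  proof (rule integrable_continuous_compact_support[OF _ g(2)])
    show "continuous_on UNIV (\<lambda>x. g x * complex_of_real (W x \<omega>))"
      by (intro continuous_intros g(1) cont that)
  qed (simp add: g(3))
  have W1 [measurable]: "(\<lambda>u. W (snd u) (fst u)) \<in> borel_measurable (M \<Otimes>\<^sub>M borel)"
    using measurable_compose[OF measurable_pair_swap' W] by (simp add: case_prod_beta')
  then show I_meas: "(\<lambda>\<omega>. LINT x|lborel. g x * of_real (W x \<omega>)) \<in> borel_measurable M"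
    by measurable
  have gg: "integrable lborel ?gg"
    using lborel_pair.integrable_mult_product[OF g_int, of "\<lambda>x. cnj (g x)"] g_int by (simp add: lborel_prod)
  let ?\<Phi> = "\<lambda>\<omega> z. ?gg z * complex_of_real (W (fst z) \<omega> * W (snd z) \<omega>)"
  have WW: "integrable M (\<lambda>\<omega>. W x \<omega> * W y \<omega>)"
    and WW_bound: "expectation (\<lambda>\<omega>. norm (W x \<omega> * W y \<omega>)) \<le> B" for x y
  proof -
    \<comment> \<open>The inequality \<open>2 * \<bar>a * b\<bar> \<le> a^2 + b^2\<close> bounds the
      mixed absolute moments by \<open>B\<close>, uniformly in \<open>x\<close> and
      \<open>y\<close>.\<close>
    have *: "norm (W x \<omega> * W y \<omega>) \<le> ((W x \<omega>)\<^sup>2 + (W y \<omega>)\<^sup>2) / 2" for \<omega>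
      using sum_squares_bound[of "\<bar>W x \<omega>\<bar>" "\<bar>W y \<omega>\<bar>"] by (simp add: abs_mult)
    have int2: "integrable M (\<lambda>\<omega>. ((W x \<omega>)\<^sup>2 + (W y \<omega>)\<^sup>2) / 2)"
      using int by simp
    show WW: "integrable M (\<lambda>\<omega>. W x \<omega> * W y \<omega>)"
    proof (rule Bochner_Integration.integrable_bound[OF int2])
      show "(\<lambda>\<omega>. W x \<omega> * W y \<omega>) \<in> borel_measurable M"
        using meas by simp
      show "AE \<omega> in M. norm (W x \<omega> * W y \<omega>) \<le> norm (((W x \<omega>)\<^sup>2 + (W y \<omega>)\<^sup>2) / 2)"
        using * by (intro AE_I2 order_trans[OF *]) simp
    qed
    have "expectation (\<lambda>\<omega>. norm (W x \<omega> * W y \<omega>)) \<le> expectation (\<lambda>\<omega>. ((W x \<omega>)\<^sup>2 + (W y \<omega>)\<^sup>2) / 2)"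
      by (rule integral_mono[OF integrable_norm[OF WW] int2 *])
    also have "\<dots> \<le> B"
      using int bound[of x] bound[of y] by simp
    finally show "expectation (\<lambda>\<omega>. norm (W x \<omega> * W y \<omega>)) \<le> B" .
  qed
  have \<Phi>_meas: "(\<lambda>u. ?\<Phi> (fst u) (snd u)) \<in> borel_measurable (M \<Otimes>\<^sub>M lborel)"
  proof -
    have "(\<lambda>u. ?\<Phi> (fst u) (snd u)) \<in> borel_measurable (M \<Otimes>\<^sub>M (borel \<Otimes>\<^sub>M borel))"
    proof -
      have [measurable]: "(\<lambda>u. W (fst (snd u)) (fst u)) \<in> borel_measurable (M \<Otimes>\<^sub>M ((borel :: (real^'d) measure) \<Otimes>\<^sub>M (borel :: (real^'d) measure)))"
      proof -
        have "(\<lambda>u. (fst u, fst (snd u))) \<in> M \<Otimes>\<^sub>M ((borel :: (real^'d) measure) \<Otimes>\<^sub>M (borel :: (real^'d) measure)) \<rightarrow>\<^sub>M M \<Otimes>\<^sub>M borel"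
          by measurable
        from measurable_compose[OF this W1] show ?thesis
          by simp
      qed
      have [measurable]: "(\<lambda>u. W (snd (snd u)) (fst u)) \<in> borel_measurable (M \<Otimes>\<^sub>M ((borel :: (real^'d) measure) \<Otimes>\<^sub>M (borel :: (real^'d) measure)))"
      proof -
        have "(\<lambda>u. (fst u, snd (snd u))) \<in> M \<Otimes>\<^sub>M ((borel :: (real^'d) measure) \<Otimes>\<^sub>M (borel :: (real^'d) measure)) \<rightarrow>\<^sub>M M \<Otimes>\<^sub>M borel"
          by measurable
        from measurable_compose[OF this W1] show ?thesis
          by simp
      qed
      show ?thesis
        by measurable
    qed
    then show ?thesis
      unfolding borel_prod by (subst measurable_cong_sets[OF sets_pair_measure_cong[OF refl sets_lborel] refl])
  qed
  have \<Phi>_int: "integrable (M \<Otimes>\<^sub>M lborel) (case_prod ?\<Phi>)"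
  proof -
    interpret Q: pair_sigma_finite "lborel :: ((real^'d) \<times> (real^'d)) measure" M ..
    have m: "(\<lambda>v. ?\<Phi> (snd v) (fst v)) \<in> borel_measurable (lborel \<Otimes>\<^sub>M M)"
      using measurable_compose[OF measurable_pair_swap' \<Phi>_meas] by (simp add: case_prod_beta')
    \<comment> \<open>Integrability is checked with the expectation as the inner integral, where
      \<open>B\<close> is a uniform bound; the two factors are swapped back afterwards.\<close>
    have "integrable (lborel \<Otimes>\<^sub>M M) (\<lambda>v. ?\<Phi> (snd v) (fst v))"
    proof (rule Q.Fubini_integrable[OF m])
      have eq: "(LINT \<omega>|M. norm (?\<Phi> (snd (z, \<omega>)) (fst (z, \<omega>)))) =
          norm (?gg z) * expectation (\<lambda>\<omega>. norm (W (fst z) \<omega> * W (snd z) \<omega>))" for z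
        unfolding norm_mult[where 'a = complex] norm_of_real fst_conv snd_conv integral_mult_right_zero
        by (simp only: real_norm_def mult.assoc)
      have m': "(\<lambda>z. LINT \<omega>|M. norm (?\<Phi> (snd (z, \<omega>)) (fst (z, \<omega>)))) \<in> borel_measurable lborel"
        using sigma_finite_measure.borel_measurable_lebesgue_integral[OF prob_space_imp_sigma_finite[OF prob_space_axioms],
            of "\<lambda>z \<omega>. norm (?\<Phi> \<omega> z)" lborel] measurable_compose[OF m borel_measurable_norm] by (simp add: case_prod_beta')
      show "integrable lborel (\<lambda>z. LINT \<omega>|M. norm (?\<Phi> (snd (z, \<omega>)) (fst (z, \<omega>))))"
      proof (rule Bochner_Integration.integrable_bound[OF integrable_mult_right[OF integrable_norm[OF gg], of B] m'])
        show "AE z in lborel. norm (LINT \<omega>|M. norm (?\<Phi> (snd (z, \<omega>)) (fst (z, \<omega>)))) \<le> norm (B * norm (?gg z))"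
          unfolding eq
        proof (rule AE_I2)
          fix z :: "(real^'d) \<times> (real^'d)"
          let ?e = "expectation (\<lambda>\<omega>. norm (W (fst z) \<omega> * W (snd z) \<omega>))"
          have "0 \<le> ?e"
            by (intro integral_nonneg_AE) simp
          moreover have "norm (?gg z) * ?e \<le> norm (?gg z) * B"
            by (intro mult_left_mono WW_bound norm_ge_zero)
          moreover have "0 \<le> B"
            using \<open>0 \<le> ?e\<close> WW_bound by (rule order_trans)
          ultimately show "norm (norm (?gg z) * ?e) \<le> norm (B * norm (?gg z))"
            by (simp only: real_norm_def abs_mult abs_of_nonneg norm_ge_zero mult.commute)
        qed
      qed
      show "AE z in lborel. integrable M (\<lambda>\<omega>. ?\<Phi> (snd (z, \<omega>)) (fst (z, \<omega>)))"
        unfolding fst_conv snd_conv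
        by (intro AE_I2 integrable_mult_right) (simp only: complex_of_real_integrable_eq WW)
    qed
    then show ?thesis
      using Q.integrable_product_swap[OF \<open>integrable (lborel \<Otimes>\<^sub>M M) _\<close>] by (simp add: case_prod_beta')
  qed
  have sq: "(LINT z|lborel. ?\<Phi> \<omega> z) = complex_of_real ((norm (LINT x|lborel. g x * of_real (W x \<omega>)))\<^sup>2)"
    if "\<omega> \<in> space M" for \<omega>
  proof -
    let ?f = "\<lambda>x. g x * of_real (W x \<omega>)"
    have f': "integrable lborel (\<lambda>x. cnj (?f x))"
      using gW[OF that] by (simp only: integrable_cnj)
    have "complex_of_real ((norm (LINT x|lborel. ?f x))\<^sup>2) = (LINT x|lborel. ?f x) * (LINT x|lborel. cnj (?f x))"
      by (simp only: complex_norm_square Bochner_Integration.integral_cnj)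
    also have "\<dots> = (LINT z|lborel. ?f (fst z) * cnj (?f (snd z)))"
      using lborel_pair.integral_mult_product[OF gW[OF that] f'] by (simp only: lborel_prod)
    also have "\<dots> = (LINT z|lborel. ?\<Phi> \<omega> z)"
      by (rule Bochner_Integration.integral_cong[OF refl]) simp
    finally show ?thesis ..
  qed
  have "integrable M (\<lambda>\<omega>. complex_of_real ((norm (LINT x|lborel. g x * of_real (W x \<omega>)))\<^sup>2))"
    using integrable_fst[OF \<Phi>_int] by (subst (asm) Bochner_Integration.integrable_cong[OF refl sq])
  then have N_int: "integrable M (\<lambda>\<omega>. (norm (LINT x|lborel. g x * of_real (W x \<omega>)))\<^sup>2)"
    by (simp only: complex_of_real_integrable_eq)
  have "complex_of_real (expectation (\<lambda>\<omega>. (norm (LINT x|lborel. g x * of_real (W x \<omega>)))\<^sup>2)) =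
      (LINT \<omega>|M. LINT z|lborel. ?\<Phi> \<omega> z)"
    unfolding integral_complex_of_real[symmetric]
    by (rule Bochner_Integration.integral_cong[OF refl]) (simp only: sq)
  also have "\<dots> = (LINT z|lborel. LINT \<omega>|M. ?\<Phi> \<omega> z)"
    by (rule Fubini_integral[OF \<Phi>_int, symmetric])
  also have "\<dots> = (LINT z|lborel. ?gg z * complex_of_real (expectation (\<lambda>\<omega>. W (fst z) \<omega> * W (snd z) \<omega>)))"
    by (simp only: integral_mult_right_zero integral_complex_of_real)
  finally have "expectation (\<lambda>\<omega>. (norm (LINT x|lborel. g x * of_real (W x \<omega>)))\<^sup>2) =
      Re (LINT z|lborel. ?gg z * complex_of_real (expectation (\<lambda>\<omega>. W (fst z) \<omega> * W (snd z) \<omega>)))"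
    by (metis Re_complex_of_real)
  then show "(\<integral>\<^sup>+\<omega>. ennreal ((norm (LINT x|lborel. g x * of_real (W x \<omega>)))\<^sup>2) \<partial>M) =
      ennreal (Re (LINT z|lborel. ?gg z * complex_of_real (expectation (\<lambda>\<omega>. W (fst z) \<omega> * W (snd z) \<omega>))))"
    using N_int by (subst nn_integral_eq_integral) auto
qed

section \<open>Divergence\<close>

text \<open>With equal times and cutoffs the kernels combine into a squared modulus, so the
  covariance is a Fourier transform of the truncated spectral density and depends on
  \<open>x - y\<close> only.\<close>

lemma psi_covariance_spectral:
  fixes H :: "real^'d"
  shows "psi_covariance c H0 H n t x n t y = complex_of_real (c\<^sup>2) *
    (LINT p|lborel. complex_of_real (indicator (D_set n) p * spectral_density H0 H t p) * cis (snd p \<bullet> (x - y)))"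
proof -
  have gg: "gamma_kernel t a b * cnj (gamma_kernel t a b) = complex_of_real ((norm (gamma_kernel t a b))\<^sup>2)" for a b
    by (simp only: complex_norm_square)
  show ?thesis
    unfolding psi_covariance_def set_lebesgue_integral_def
    by (intro arg_cong2[of _ _ _ _ "(*)"] refl Bochner_Integration.integral_cong)
      (simp add: spectral_density_def spectral_weight_def gg mult.assoc case_prod_beta' indicator_def
        del: of_real_power)
qed

theorem proposition1p13:
  fixes M :: "'w measure"
    and \<Psi> :: "nat \<Rightarrow> real \<Rightarrow> real^'d \<Rightarrow> 'w \<Rightarrow> real"
    and H0 c :: real
    and H :: "real^'d"
    and \<rho> :: "real^'d \<Rightarrow> real"
  assumes "prob_space M"
    and "0 < c"
    and "0 < H0" and "H0 < 1"
    and "\<And>i. 0 < H $ i" and "\<And>i. H $ i < 1"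
    and "psi_process M c H0 H \<Psi>"
    and "2 * H0 + (\<Sum>i\<in>UNIV. H $ i) \<le> 3 / 4 * real CARD('d)"
    and "smooth_function \<rho>" and "compactly_supported \<rho>" and "\<exists>x. \<rho> x \<noteq> 0"
  shows "\<forall>\<alpha>>0. \<forall>t>0.
    ((\<lambda>n. \<integral>\<^sup>+\<omega>. (sobolev_norm (- 2 * \<alpha>)
                 (\<lambda>x. complex_of_real (\<rho> x * wick_square M \<Psi> n t x \<omega>)))\<^sup>2 \<partial>M)
      \<longlongrightarrow> \<infinity>) sequentially"
proof (intro allI impI)
  fix \<alpha> t :: real assume "0 < \<alpha>" "0 < t"
  interpret prob_space M by fact

  \<comment> \<open>The weight \<open>g\<close> and a ball on which its Fourier transform is bounded
    below\<close>
  obtain x0 where x0: "\<rho> x0 \<noteq> 0"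
    using assms(11) by blast
  define S where "S = closure {x. \<rho> x \<noteq> 0}"
  have S: "compact S" "\<And>x. x \<notin> S \<Longrightarrow> \<rho> x = 0"
    using assms(10) closure_subset[of "{x. \<rho> x \<noteq> 0}"] by (auto simp: S_def compactly_supported_def)
  \<comment> \<open>The empty list of derivatives gives differentiability of \<open>\<rho>\<close>
    itself.\<close>
  have "\<rho> differentiable (at x)" for x
    using assms(9)[unfolded smooth_function_def, rule_format, of "[]" x]
    by (simp add: iterated_partial_derivative_def)
  then have \<rho>_cont: "continuous_on UNIV \<rho>"
    by (simp add: continuous_on_eq_continuous_at differentiable_imp_continuous_within)
  obtain \<psi> where \<psi>: "continuous_on UNIV \<psi>" "\<psi> x0 \<noteq> 0"
    and bessel: "\<And>f. bessel_potential (- 2 * \<alpha>) (distribution_of f) (gaussian_at x0) = (LINT x|lborel. f x * \<psi> x)"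
    using bessel_potential_gaussian_at[of "- 2 * \<alpha>" x0] \<open>0 < \<alpha>\<close> by (metis less_imp_le mult_less_0_iff neg_less_0_iff_less zero_less_numeral)
  define g where "g x = complex_of_real (\<rho> x) * \<psi> x" for x
  have g: "continuous_on UNIV g" "\<And>x. x \<notin> S \<Longrightarrow> g x = 0"
    using S(2) unfolding g_def by (auto intro!: continuous_intros \<rho>_cont \<psi>(1))
  have g_int: "integrable lborel g"
    by (rule integrable_continuous_compact_support[OF g(1) S(1) g(2)])
  define G where "G \<zeta> = (LINT x|lborel. g x * cis (\<zeta> \<bullet> x))" for \<zeta>
  have G_cont: "continuous_on UNIV G"
    using continuous_integral_cis[OF g_int] by (simp add: G_def[abs_def])
  \<comment> \<open>Both factors of \<open>g x0\<close> are nonzero, so by injectivity the Fourier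
    transform of \<open>g\<close> cannot vanish identically.\<close>
  obtain \<zeta>0 where "G \<zeta>0 \<noteq> 0"
    using fourier_transform_inj[OF g(1) S(1) g(2), of x0] x0 \<psi>(2) by (auto simp: G_def g_def)
  define F where "F \<zeta> = (norm (G \<zeta>))\<^sup>2" for \<zeta>
  have F_cont: "continuous_on UNIV F"
    unfolding F_def by (intro continuous_intros G_cont)
  then have F_meas [measurable]: "F \<in> borel_measurable borel"
    by (rule borel_measurable_continuous_onI)
  define \<delta> where "\<delta> = F \<zeta>0 / 2"
  have "0 < \<delta>"
    using \<open>G \<zeta>0 \<noteq> 0\<close> by (simp add: \<delta>_def F_def)
  obtain \<epsilon> where "0 < \<epsilon>" and \<epsilon>: "\<And>\<zeta>. \<zeta> \<in> ball \<zeta>0 \<epsilon> \<Longrightarrow> \<delta> \<le> F \<zeta>"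
  proof -
    have "open {\<zeta>. \<delta> < F \<zeta>}"
      by (rule open_Collect_less[OF continuous_on_const F_cont])
    moreover have "\<zeta>0 \<in> {\<zeta>. \<delta> < F \<zeta>}"
      using \<open>0 < \<delta>\<close> by (simp add: \<delta>_def)
    ultimately obtain e where "0 < e" "ball \<zeta>0 e \<subseteq> {\<zeta>. \<delta> < F \<zeta>}"
      unfolding open_contains_ball by blast
    then show ?thesis
      by (intro that[of e]) (auto simp: subset_iff less_imp_le)
  qed

  \<comment> \<open>Divergence of the truncated spectral integrals\<close>
  define w where "w n p = indicator (D_set n) p * spectral_density H0 H t p" for n p
  define J where "J n = (\<integral>\<^sup>+q. ennreal (w n (fst q) * w n (snd q) * F (snd (fst q) + snd (snd q))) \<partial>lborel)" for n
  have snd_meas [measurable]: "snd \<in> borel_measurable (borel :: (real \<times> (real^'d)) measure)"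
    unfolding borel_prod[symmetric] by measurable
  have w_meas [measurable]: "w n \<in> borel_measurable borel" for n
    unfolding w_def[abs_def] by measurable
  have w_int: "integrable lborel (w n)" for n
    unfolding w_def[abs_def] using spectral_density_integrable[OF assms(4,6)] \<open>0 < t\<close> by simp
  have J_lim: "J \<longlonglongrightarrow> \<infinity>"
  proof -
    let ?u = "\<lambda>q. spectral_density H0 H t (fst q) * spectral_density H0 H t (snd q) * F (snd (fst q) + snd (snd q))"
    let ?u' = "\<lambda>n q. w n (fst q) * w n (snd q) * F (snd (fst q) + snd (snd q))"
    have meas: "?u' n \<in> borel_measurable borel" "?u \<in> borel_measurable borel" for n
      unfolding borel_prod[symmetric, where 'a = "real \<times> (real^'d)" and 'b = "real \<times> (real^'d)"] by measurable
    have D_mono: "D_set m \<subseteq> (D_set n :: (real \<times> (real^'d)) set)" if "m \<le> n" for m n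
    proof -
      have "(2::real) ^ (2 * m) \<le> 2 ^ (2 * n)" "(2::real) ^ m \<le> 2 ^ n"
        using that by (auto intro!: power_increasing)
      then show ?thesis
        by (auto simp: D_set_def intro: order_trans)
    qed
    have D_ev: "eventually (\<lambda>n. p \<in> D_set n) sequentially" for p :: "real \<times> (real^'d)"
    proof -
      obtain m where m: "\<bar>fst p\<bar> + norm (snd p) < 2 ^ m"
        using real_arch_pow[of 2 "\<bar>fst p\<bar> + norm (snd p)"] by auto
      have "(2::real) ^ m \<le> 2 ^ (2 * m)"
        by (intro power_increasing) auto
      then have "\<bar>fst p\<bar> \<le> 2 ^ (2 * m)" "norm (snd p) \<le> 2 ^ m"
        using m norm_ge_zero[of "snd p"] abs_ge_zero[of "fst p"] by linarith+
      then have "p \<in> D_set m"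
        by (simp add: D_set_def case_prod_beta')
      then show ?thesis
        using D_mono by (auto simp: eventually_sequentially)
    qed
    \<comment> \<open>Monotone convergence: the sets \<open>D_set n\<close> increase to the whole
      space and all factors are nonnegative.\<close>
    have "J \<longlonglongrightarrow> (\<integral>\<^sup>+q. ennreal (?u q) \<partial>lborel)"
      unfolding J_def[abs_def]
    proof (rule nn_integral_LIMSEQ)
      have w_mono: "0 \<le> w m p" "w m p \<le> w n p" if "m \<le> n" for m n p
        using D_mono[OF that] spectral_density_nonneg[of H0 H t p] by (auto simp: w_def indicator_def)
      show "incseq (\<lambda>n q. ennreal (?u' n q))"
        unfolding incseq_def le_fun_def
        by (intro allI impI ennreal_leI mult_right_mono mult_mono w_mono order_trans[OF w_mono(1) w_mono(2)])
          (auto simp: F_def)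
      show "(\<lambda>q. ennreal (?u' n q)) \<in> borel_measurable lborel" for n
        using meas(1)[of n] by simp
      show "(\<lambda>n. ennreal (?u' n q)) \<longlonglongrightarrow> ennreal (?u q)" for q
        by (rule tendsto_eventually, use D_ev[of "fst q"] D_ev[of "snd q"] in eventually_elim)
          (simp add: w_def)
    qed
    also have "(\<integral>\<^sup>+q. ennreal (?u q) \<partial>lborel) =
        (\<integral>\<^sup>+p. (\<integral>\<^sup>+q. ennreal (spectral_density H0 H t p * spectral_density H0 H t q * F (snd p + snd q))
          \<partial>lborel) \<partial>lborel)"
      using lborel.nn_integral_fst[of "\<lambda>q. ennreal (?u q)" lborel] meas(2) by (simp add: lborel_prod)
    also have "\<dots> = \<infinity>"
      by (rule spectral_convolution_diverges[OF assms(3-6,8) \<open>0 < t\<close> \<open>0 < \<delta>\<close> \<open>0 < \<epsilon>\<close> F_meas \<epsilon>])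
    finally show ?thesis .
  qed

  \<comment> \<open>Gaussianity and covariance of the field at the fixed time\<close>
  have \<Psi>_meas: "\<Psi> n t x \<in> borel_measurable M" and \<Psi>_mean: "expectation (\<Psi> n t x) = 0"
    and \<Psi>_comb: "\<And>Y k. finite Y \<Longrightarrow> gaussian_rv M (\<lambda>\<omega>. \<Sum>y\<in>Y. k y * \<Psi> n t y \<omega>)"
    if "1 \<le> n" for n x
  proof -
    let ?I = "{(n, s, x). n \<ge> 1 \<and> s \<ge> 0} :: (nat \<times> real \<times> (real^'d)) set"
    have cgp: "centered_gaussian_process M ?I (\<lambda>(n, s, x). \<Psi> n s x)"
      using assms(7) by (simp add: psi_process_def)
    have "(n, t, x) \<in> ?I"
      using that \<open>0 < t\<close> by simp
    then show "\<Psi> n t x \<in> borel_measurable M" "expectation (\<Psi> n t x) = 0"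
      using cgp unfolding centered_gaussian_process_def by fastforce+
    fix Y :: "(real^'d) set" and k :: "real^'d \<Rightarrow> real" assume "finite Y"
    let ?J = "(\<lambda>y. (n, t, y)) ` Y"
    have "finite ?J" "?J \<subseteq> ?I"
      using \<open>finite Y\<close> that \<open>0 < t\<close> by auto
    then have "gaussian_rv M (\<lambda>\<omega>. \<Sum>j\<in>?J. (\<lambda>(n, s, x). k x) j * (\<lambda>(n, s, x). \<Psi> n s x) j \<omega>)"
      using cgp unfolding centered_gaussian_process_def by blast
    moreover have "(\<Sum>j\<in>?J. (\<lambda>(n, s, x). k x) j * (\<lambda>(n, s, x). \<Psi> n s x) j \<omega>) = (\<Sum>y\<in>Y. k y * \<Psi> n t y \<omega>)" for \<omega>
      by (subst sum.reindex) (auto simp: inj_on_def)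
    ultimately show "gaussian_rv M (\<lambda>\<omega>. \<Sum>y\<in>Y. k y * \<Psi> n t y \<omega>)"
      by simp
  qed
  \<comment> \<open>For \<open>x = y\<close> the set \<open>{x, y}\<close> collapses to a singleton,
    so the coefficients have to be added first.\<close>
  have gauss: "gaussian_rv M (\<lambda>\<omega>. a * \<Psi> n t x \<omega> + b * \<Psi> n t y \<omega>)" if "1 \<le> n" for n x y a b
  proof (cases "x = y")
    case True
    then show ?thesis
      using \<Psi>_comb[OF that, of "{x}" "\<lambda>_. a + b"] by (simp add: distrib_right)
  next
    case False
    then show ?thesis
      using \<Psi>_comb[OF that, of "{x, y}" "\<lambda>z. if z = x then a else b"] by simp
  qed
  have \<Psi>_int: "integrable M (\<Psi> n t x)" if "1 \<le> n" for n x
  proof (rule square_integrable_imp_integrable[OF \<Psi>_meas[OF that]])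
    show "integrable M (\<lambda>\<omega>. (\<Psi> n t x \<omega>)\<^sup>2)"
      using gauss[OF that, of 1 x 0 x] \<Psi>_mean[OF that, of x]
      by (intro centered_gaussian_rv_moments(1)) simp_all
  qed
  have mean: "expectation (\<lambda>\<omega>. a * \<Psi> n t x \<omega> + b * \<Psi> n t y \<omega>) = 0" if "1 \<le> n" for n x y a b
    using \<Psi>_int[OF that] \<Psi>_mean[OF that] by simp
  define C where "C n x y = (LINT p|lborel. complex_of_real (w n p) * cis (snd p \<bullet> (x - y)))" for n x y
  have cov: "complex_of_real (expectation (\<lambda>\<omega>. \<Psi> n t x \<omega> * \<Psi> n t y \<omega>)) = complex_of_real (c\<^sup>2) * C n x y"
    if "1 \<le> n" for n x y
    using assms(7) that \<open>0 < t\<close> unfolding C_def w_def psi_covariance_spectral[symmetric]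
    by (simp add: psi_process_def)
  \<comment> \<open>The variance is the same at every \<open>x\<close>. This makes the Wick square
    continuous in \<open>x\<close> and bounds its second moment uniformly by
    \<open>2 * (v n)^2\<close>.\<close>
  define v where "v n = c\<^sup>2 * (LINT p|lborel. w n p)" for n
  have var: "expectation (\<lambda>\<omega>. (\<Psi> n t x \<omega>)\<^sup>2) = v n" if "1 \<le> n" for n x
  proof -
    have C_xx: "C n x x = complex_of_real (LINT p|lborel. w n p)"
      unfolding C_def by simp
    have "complex_of_real (expectation (\<lambda>\<omega>. (\<Psi> n t x \<omega>)\<^sup>2)) = complex_of_real (v n)"
      unfolding power2_eq_square[of "\<Psi> n t x _"] cov[OF that] C_xx v_def by (rule of_real_mult[symmetric])
    then show ?thesis
      by (simp only: of_real_eq_iff)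
  qed

  \<comment> \<open>Second moment of the pairing of \<open>g\<close> with the Wick square\<close>
  define W where "W n x \<omega> = wick_square M \<Psi> n t x \<omega>" for n x \<omega>
  have moment: "(\<integral>\<^sup>+\<omega>. ennreal ((norm (LINT x|lborel. g x * of_real (W n x \<omega>)))\<^sup>2) \<partial>M) = ennreal (2 * c ^ 4) * J n"
    and meas: "(\<lambda>\<omega>. LINT x|lborel. g x * of_real (W n x \<omega>)) \<in> borel_measurable M"
    if n: "1 \<le> n" for n
  proof -
    note wick = wick_square_covariance[of "\<Psi> n t _" "\<Psi> n t _", OF gauss[OF n] mean[OF n]]
    have WW: "integrable M (\<lambda>\<omega>. W n x \<omega> * W n y \<omega>)"
      "expectation (\<lambda>\<omega>. W n x \<omega> * W n y \<omega>) = 2 * (expectation (\<lambda>\<omega>. \<Psi> n t x \<omega> * \<Psi> n t y \<omega>))\<^sup>2" for x y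
      using wick[of x y] by (simp_all add: W_def wick_square_def)
    have W_meas: "W n x \<in> borel_measurable M" for x
      using \<Psi>_meas[OF n] unfolding W_def[abs_def] wick_square_def by simp
    have W_cont: "continuous_on UNIV (\<lambda>x. W n x \<omega>)" if "\<omega> \<in> space M" for \<omega>
    proof -
      have "continuous_on ({0..} \<times> UNIV) (\<lambda>(s, x). \<Psi> n s x \<omega>)"
        using assms(7) n that by (simp add: psi_process_def)
      then have "continuous_on UNIV (\<lambda>x. (\<lambda>(s, x). \<Psi> n s x \<omega>) (t, x))"
      proof (rule continuous_on_compose2)
        show "continuous_on UNIV (\<lambda>x::real^'d. (t, x))"
          by (intro continuous_intros)
      qed (use \<open>0 < t\<close> in auto)
      then show ?thesis
        by (auto simp: W_def wick_square_def var[OF n] intro!: continuous_intros)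
    qed
    have W_int: "integrable M (\<lambda>\<omega>. (W n x \<omega>)\<^sup>2)" and W_bound: "expectation (\<lambda>\<omega>. (W n x \<omega>)\<^sup>2) \<le> 2 * (v n)\<^sup>2" for x
      using WW[of x x] var[OF n, of x] by (simp_all add: power2_eq_square)
    note second = second_moment_of_integral[of "W n", OF W_meas W_cont g(1) S(1) g(2) W_int W_bound]
    show "(\<lambda>\<omega>. LINT x|lborel. g x * of_real (W n x \<omega>)) \<in> borel_measurable M"
      by (rule second(1))
    note quad = spectral_quadratic_form[OF w_int[of n] g_int snd_meas, folded G_def F_def C_def]
    have "complex_of_real (expectation (\<lambda>\<omega>. W n x \<omega> * W n y \<omega>)) = complex_of_real (2 * c ^ 4) * (C n x y)\<^sup>2" for x y
    proof -
      have "complex_of_real (expectation (\<lambda>\<omega>. W n x \<omega> * W n y \<omega>)) =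
          2 * (complex_of_real (expectation (\<lambda>\<omega>. \<Psi> n t x \<omega> * \<Psi> n t y \<omega>)))\<^sup>2"
        unfolding WW by simp
      also have "\<dots> = complex_of_real (2 * c ^ 4) * (C n x y)\<^sup>2"
        unfolding cov[OF n] by (simp add: power_mult_distrib flip: power_mult)
      finally show ?thesis .
    qed
    then have "(LINT z|lborel. g (fst z) * cnj (g (snd z)) *
          complex_of_real (expectation (\<lambda>\<omega>. W n (fst z) \<omega> * W n (snd z) \<omega>))) =
        (LINT z|lborel. complex_of_real (2 * c ^ 4) * (g (fst z) * cnj (g (snd z)) * (C n (fst z) (snd z))\<^sup>2))"
      by (simp only: mult_ac)
    also have "\<dots> = complex_of_real (2 * c ^ 4 * (LINT q|lborel. w n (fst q) * w n (snd q) * F (snd (fst q) + snd (snd q))))"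
      by (simp only: integral_mult_right_zero quad(2) of_real_mult)
    finally have L: "(LINT z|lborel. g (fst z) * cnj (g (snd z)) *
          complex_of_real (expectation (\<lambda>\<omega>. W n (fst z) \<omega> * W n (snd z) \<omega>))) =
        complex_of_real (2 * c ^ 4 * (LINT q|lborel. w n (fst q) * w n (snd q) * F (snd (fst q) + snd (snd q))))" .
    have "(\<integral>\<^sup>+\<omega>. ennreal ((norm (LINT x|lborel. g x * of_real (W n x \<omega>)))\<^sup>2) \<partial>M) =
        ennreal (Re (LINT z|lborel. g (fst z) * cnj (g (snd z)) *
          complex_of_real (expectation (\<lambda>\<omega>. W n (fst z) \<omega> * W n (snd z) \<omega>))))"
      by (rule second(2))
    also note L
    also note Re_complex_of_real
    finally have "(\<integral>\<^sup>+\<omega>. ennreal ((norm (LINT x|lborel. g x * of_real (W n x \<omega>)))\<^sup>2) \<partial>M) =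
        ennreal (2 * c ^ 4 * (LINT q|lborel. w n (fst q) * w n (snd q) * F (snd (fst q) + snd (snd q))))"
      .
    also have "\<dots> = ennreal (2 * c ^ 4) * ennreal (LINT q|lborel. w n (fst q) * w n (snd q) * F (snd (fst q) + snd (snd q)))"
      using \<open>0 < c\<close> by (intro ennreal_mult') simp
    also have "ennreal (LINT q|lborel. w n (fst q) * w n (snd q) * F (snd (fst q) + snd (snd q))) = J n"
      unfolding J_def
      by (rule nn_integral_eq_integral[symmetric, OF quad(1)])
        (simp add: w_def F_def spectral_density_nonneg)
    finally show "(\<integral>\<^sup>+\<omega>. ennreal ((norm (LINT x|lborel. g x * of_real (W n x \<omega>)))\<^sup>2) \<partial>M) = ennreal (2 * c ^ 4) * J n" .
  qed

  \<comment> \<open>Comparison with the Sobolev norm\<close>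
  define N where "N = L2_norm (gaussian_at x0)"
  have "0 < N"
    unfolding N_def by (rule L2_norm_gaussian_at_pos)
  \<comment> \<open>The factor \<open>1 / N^2\<close> comes from duality and \<open>2 * c^4\<close>
    from Wick's formula with covariance \<open>c^2 * C\<close>; the product is independent of
    \<open>n\<close>.\<close>
  define K where "K = 1 / N\<^sup>2 * (2 * c ^ 4)"
  have "0 < K"
    using \<open>0 < N\<close> \<open>0 < c\<close> by (simp add: K_def)
  define E where "E n = (\<integral>\<^sup>+\<omega>. (sobolev_norm (- 2 * \<alpha>)
    (\<lambda>x. complex_of_real (\<rho> x * wick_square M \<Psi> n t x \<omega>)))\<^sup>2 \<partial>M)" for n
  have lower: "ennreal K * J n \<le> E n" if n: "1 \<le> n" for n
  proof -
    let ?T = "\<lambda>\<omega>. LINT x|lborel. g x * of_real (W n x \<omega>)"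
    have "ennreal K = ennreal (1 / N\<^sup>2) * ennreal (2 * c ^ 4)"
      unfolding K_def by (rule ennreal_mult) simp_all
    then have "ennreal K * J n = ennreal (1 / N\<^sup>2) * (\<integral>\<^sup>+\<omega>. ennreal ((norm (?T \<omega>))\<^sup>2) \<partial>M)"
      by (simp only: moment[OF n] mult.assoc)
    also have "\<dots> = (\<integral>\<^sup>+\<omega>. ennreal (1 / N\<^sup>2) * ennreal ((norm (?T \<omega>))\<^sup>2) \<partial>M)"
      using meas[OF n] by (intro nn_integral_cmult[symmetric]) simp
    \<comment> \<open>The duality bound holds for each \<open>\<omega>\<close> separately, so
      monotonicity of the integral gives the inequality without measurability of the Sobolev
      norm.\<close>
    also have "\<dots> \<le> E n"
      unfolding E_def
    proof (rule nn_integral_mono)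
      fix \<omega>
      let ?f = "\<lambda>x. complex_of_real (\<rho> x * wick_square M \<Psi> n t x \<omega>)"
      have "bessel_potential (- 2 * \<alpha>) (distribution_of ?f) (gaussian_at x0) = ?T \<omega>"
        unfolding bessel by (simp add: g_def W_def mult_ac)
      then have "ennreal (norm (?T \<omega>) / N) \<le> sobolev_norm (- 2 * \<alpha>) ?f"
        using L2_norm_distribution_ge[OF schwartz_gaussian_at gaussian_at_square_integrable,
            of "bessel_potential (- 2 * \<alpha>) (distribution_of ?f)" x0]
        by (simp add: sobolev_norm_def N_def)
      then have "(ennreal (norm (?T \<omega>) / N))\<^sup>2 \<le> (sobolev_norm (- 2 * \<alpha>) ?f)\<^sup>2"
        by (rule power_mono) simp
      then show "ennreal (1 / N\<^sup>2) * ennreal ((norm (?T \<omega>))\<^sup>2) \<le> (sobolev_norm (- 2 * \<alpha>) ?f)\<^sup>2"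
        using \<open>0 < N\<close> by (simp add: ennreal_power power_divide flip: ennreal_mult)
    qed
    finally show ?thesis .
  qed
  have "(\<lambda>n. ennreal K * J n) \<longlonglongrightarrow> ennreal K * \<infinity>"
    by (rule ennreal_tendsto_cmult[OF _ J_lim]) simp
  then have "(\<lambda>n. ennreal K * J n) \<longlonglongrightarrow> \<infinity>"
    using \<open>0 < K\<close> by (simp add: ennreal_mult_top)
  \<comment> \<open>The lower bound is available from \<open>n = 1\<close> on, where the process is
    specified, and this suffices for the limit.\<close>
  then have "E \<longlonglongrightarrow> \<infinity>"
    by (rule tendsto_sandwich[OF _ _ _ tendsto_const, rotated 2])
      (use lower in \<open>auto simp: eventually_sequentially\<close>)
  then show "((\<lambda>n. \<integral>\<^sup>+\<omega>. (sobolev_norm (- 2 * \<alpha>)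
                 (\<lambda>x. complex_of_real (\<rho> x * wick_square M \<Psi> n t x \<omega>)))\<^sup>2 \<partial>M)
      \<longlongrightarrow> \<infinity>) sequentially"
    by (simp only: E_def[abs_def])
qed

end
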